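(* For all integers $n\ge 2$, $$d_{SK}(E_1^n)\ \ge\ \frac{n}{2\sqrt{n-1}}.$$ Hence in particular $d_{SK}(E_1^n)>1$ for all $n\ge 3$.
   Context: An operator space is a closed subspace $E\subset B(H)$, $H$ a complex Hilbert space, with the norms on $M_n(E)$ induced by $B(\ell_2^n(H))$. For linear $u:E\to F$, $\|u\|_{cb}=\sup_{n\ge1}\|I_{M_n}\otimes u\|_{M_n(E)\to M_n(F)}$. For operator spaces $E,F$, $d_{cb}(E,F)=\inf\{\|u\|_{cb}\|u^{-1}\|_{cb}\}$ over all isomorphisms $u:E\to F$ ($=\infty$ if there is no complete isomorphism). Let $K=K(\ell_2)$ be the space of compact operators on $\ell_2$, and $$d_{SK}(E)=\inf\{d_{cb}(E,F)\mid F\subset K\text{ a closed subspace}\};$$ for finite dimensional $E$ this equals $\inf\{d_{cb}(E,F)\mid F\subset M_k,\ k\ge1\}$. The dual $E^*$ of an operator space $E$ carries the dual operator space structure $M_n(E^* )=cb(E,M_n)$ (isometrically). The space $\ell_\infty^n$ has its natural structure (diagonal matrices in $M_n$), and $E_1^n=(\ell_\infty^n)^*$ is its operator space dual. As a Banach space $E_1^n$ is $\ell_1^n$, and its canonical basis $e_1,\dots,e_n$ satisfies, for all $a_1,\dots,a_n\in B=B(\ell_2)$, $\|\sum e_i\otimes a_i\|_{E_1^n\otimes_{\min}B}=\sup\|\sum u_i\otimes a_i\|_{B\otimes_{\min}B}$, the supremum being over all unitaries $u_1,\dots,u_n\in B$, where $\otimes_{\min}$ is the minimal (spatial) tensor product.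 *)

theory Defs
  imports "HOL-Analysis.Analysis" "HOL-Library.Function_Algebras"
begin

section \<open>Complex vector spaces\<close>

class complex_vector = ab_group_add +
  fixes scaleC :: "complex \<Rightarrow> 'a \<Rightarrow> 'a"  (infixr \<open>*\<^sub>C\<close> 75)
  assumes scaleC_add_right: "c *\<^sub>C (x + y) = c *\<^sub>C x + c *\<^sub>C y"
    and scaleC_add_left: "(c + d) *\<^sub>C x = c *\<^sub>C x + d *\<^sub>C x"
    and scaleC_scaleC: "c *\<^sub>C (d *\<^sub>C x) = (c * d) *\<^sub>C x"
    and scaleC_one: "1 *\<^sub>C x = x"

class complex_normed_vector = complex_vector + real_normed_vector +
  assumes scaleR_scaleC: "r *\<^sub>R x = complex_of_real r *\<^sub>C x"
    and norm_scaleC: "norm (c *\<^sub>C x) = cmod c * norm x"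

definition csubspace :: "'a::complex_vector set \<Rightarrow> bool" where
  "csubspace S \<longleftrightarrow> 0 \<in> S \<and> (\<forall>x\<in>S. \<forall>y\<in>S. x + y \<in> S) \<and> (\<forall>c. \<forall>x\<in>S. c *\<^sub>C x \<in> S)"

definition clinear_on :: "'a::complex_vector set \<Rightarrow> ('a \<Rightarrow> 'b::complex_vector) \<Rightarrow> bool" where
  "clinear_on S f \<longleftrightarrow>
     (\<forall>x\<in>S. \<forall>y\<in>S. f (x + y) = f x + f y) \<and> (\<forall>c. \<forall>x\<in>S. f (c *\<^sub>C x) = c *\<^sub>C f x)"

instantiation complex :: complex_normed_vector
begin
definition scaleC_complex :: "complex \<Rightarrow> complex \<Rightarrow> complex" where
  "scaleC_complex c x = c * x"
instance
  by standard (simp_all add: scaleC_complex_def algebra_simps norm_mult scaleR_conv_of_real)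
end

instantiation "fun" :: (type, complex_vector) complex_vector
begin
definition scaleC_fun :: "complex \<Rightarrow> ('a \<Rightarrow> 'b) \<Rightarrow> 'a \<Rightarrow> 'b" where
  "scaleC_fun c f = (\<lambda>x. c *\<^sub>C f x)"
instance
  by standard
    (simp_all add: scaleC_fun_def fun_eq_iff scaleC_add_right scaleC_add_left scaleC_scaleC scaleC_one)
end

lemma bounded_linear_scaleC:
  fixes f :: "'a::real_normed_vector \<Rightarrow> 'b::complex_normed_vector"
  assumes "bounded_linear f"
  shows "bounded_linear (\<lambda>x. c *\<^sub>C f x)"
proof -
  interpret f: bounded_linear f by fact
  obtain K where K: "\<And>x. norm (f x) \<le> norm x * K" using f.bounded by blast
  show ?thesis
  proof (rule bounded_linear_intro[where K = "cmod c * K"])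
    show "c *\<^sub>C f (x + y) = c *\<^sub>C f x + c *\<^sub>C f y" for x y
      by (simp add: f.add scaleC_add_right)
    show "c *\<^sub>C f (r *\<^sub>R x) = r *\<^sub>R (c *\<^sub>C f x)" for r x
      by (simp add: f.scaleR scaleR_scaleC scaleC_scaleC mult.commute)
    show "norm (c *\<^sub>C f x) \<le> norm x * (cmod c * K)" for x
      using mult_left_mono[OF K[of x] norm_ge_zero[of c]] by (simp add: norm_scaleC mult_ac)
  qed
qed

instantiation blinfun :: (real_normed_vector, complex_normed_vector) complex_vector
begin
lift_definition scaleC_blinfun :: "complex \<Rightarrow> 'a \<Rightarrow>\<^sub>L 'b \<Rightarrow> 'a \<Rightarrow>\<^sub>L 'b" is "\<lambda>c f x. c *\<^sub>C f x"
  by (rule bounded_linear_scaleC)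
instance
  by standard
    (transfer; simp add: fun_eq_iff scaleC_add_right scaleC_add_left scaleC_scaleC scaleC_one)+
end


section \<open>The Hilbert space \<open>\<ell>\<^sub>2\<close> and its compact operators\<close>

typedef ell2 = "{x :: nat \<Rightarrow> complex. summable (\<lambda>i. (cmod (x i))\<^sup>2)}"
  morphisms ell2_nth Abs_ell2
  by (rule exI[of _ "\<lambda>_. 0"]) simp

setup_lifting type_definition_ell2

lemma ell2_triangle:
  fixes x y :: "nat \<Rightarrow> complex"
  assumes x: "summable (\<lambda>i. (cmod (x i))\<^sup>2)" and y: "summable (\<lambda>i. (cmod (y i))\<^sup>2)"
  shows "summable (\<lambda>i. (cmod (x i + y i))\<^sup>2)"
    and "sqrt (\<Sum>i. (cmod (x i + y i))\<^sup>2) \<le> sqrt (\<Sum>i. (cmod (x i))\<^sup>2) + sqrt (\<Sum>i. (cmod (y i))\<^sup>2)"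
proof -
  let ?R = "sqrt (\<Sum>i. (cmod (x i))\<^sup>2) + sqrt (\<Sum>i. (cmod (y i))\<^sup>2)"
  have R0: "0 \<le> ?R" by (intro add_nonneg_nonneg real_sqrt_ge_zero suminf_nonneg x y) auto
  have part: "(\<Sum>i<n. (cmod (x i + y i))\<^sup>2) \<le> ?R\<^sup>2" for n
  proof -
    have "L2_set (\<lambda>i. cmod (x i + y i)) {..<n} \<le> L2_set (\<lambda>i. cmod (x i) + cmod (y i)) {..<n}"
      by (intro L2_set_mono norm_triangle_ineq) auto
    also have "\<dots> \<le> L2_set (\<lambda>i. cmod (x i)) {..<n} + L2_set (\<lambda>i. cmod (y i)) {..<n}"
      by (rule L2_set_triangle_ineq)
    also have "\<dots> \<le> ?R"
      unfolding L2_set_def by (intro add_mono real_sqrt_le_mono sum_le_suminf x y) auto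
    finally have "sqrt (\<Sum>i<n. (cmod (x i + y i))\<^sup>2) \<le> ?R" by (simp add: L2_set_def)
    then show ?thesis by (rule sqrt_le_D)
  qed
  show s: "summable (\<lambda>i. (cmod (x i + y i))\<^sup>2)"
    by (rule summableI_nonneg_bounded[of _ "?R\<^sup>2"]) (use part in auto)
  have "(\<Sum>i. (cmod (x i + y i))\<^sup>2) \<le> ?R\<^sup>2" by (rule suminf_le_const[OF s part])
  then show "sqrt (\<Sum>i. (cmod (x i + y i))\<^sup>2) \<le> ?R" using R0 by (rule real_le_lsqrt[rotated])
qed

instantiation ell2 :: complex_normed_vector
begin

lift_definition zero_ell2 :: ell2 is "\<lambda>_. 0" by simp
lift_definition plus_ell2 :: "ell2 \<Rightarrow> ell2 \<Rightarrow> ell2" is "\<lambda>x y i. x i + y i"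
  by (rule ell2_triangle(1))
lift_definition uminus_ell2 :: "ell2 \<Rightarrow> ell2" is "\<lambda>x i. - x i" by simp
lift_definition minus_ell2 :: "ell2 \<Rightarrow> ell2 \<Rightarrow> ell2" is "\<lambda>x y i. x i - y i"
  using ell2_triangle(1)[of _ "\<lambda>i. - y i" for y] by simp
lift_definition scaleC_ell2 :: "complex \<Rightarrow> ell2 \<Rightarrow> ell2" is "\<lambda>c x i. c * x i"
  by (simp add: norm_mult power_mult_distrib summable_mult)
lift_definition scaleR_ell2 :: "real \<Rightarrow> ell2 \<Rightarrow> ell2" is "\<lambda>r x i. complex_of_real r * x i"
  by (simp add: norm_mult power_mult_distrib summable_mult)
lift_definition norm_ell2 :: "ell2 \<Rightarrow> real" is "\<lambda>x. sqrt (\<Sum>i. (cmod (x i))\<^sup>2)" .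
definition dist_ell2 :: "ell2 \<Rightarrow> ell2 \<Rightarrow> real" where "dist_ell2 x y = norm (x - y)"
definition sgn_ell2 :: "ell2 \<Rightarrow> ell2" where "sgn_ell2 x = inverse (norm x) *\<^sub>R x"
definition uniformity_ell2 :: "(ell2 \<times> ell2) filter" where
  "uniformity_ell2 = (INF e\<in>{0<..}. principal {(x, y). dist x y < e})"
definition open_ell2 :: "ell2 set \<Rightarrow> bool" where
  "open_ell2 U \<longleftrightarrow> (\<forall>x\<in>U. \<forall>\<^sub>F (x', y) in uniformity. x' = x \<longrightarrow> y \<in> U)"

instance
proof
  fix x y z :: ell2 and r s :: real and c d :: complex
  show "x + y + z = x + (y + z)" "x + y = y + x" "0 + x = x" "- x + x = 0" "x - y = x + - y"
    by (transfer; simp add: algebra_simps fun_eq_iff)+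
  show "c *\<^sub>C (x + y) = c *\<^sub>C x + c *\<^sub>C y" "(c + d) *\<^sub>C x = c *\<^sub>C x + d *\<^sub>C x"
    "c *\<^sub>C (d *\<^sub>C x) = (c * d) *\<^sub>C x" "1 *\<^sub>C x = x"
    by (transfer; simp add: algebra_simps fun_eq_iff)+
  show "r *\<^sub>R (x + y) = r *\<^sub>R x + r *\<^sub>R y" "(r + s) *\<^sub>R x = r *\<^sub>R x + s *\<^sub>R x"
    "r *\<^sub>R (s *\<^sub>R x) = (r * s) *\<^sub>R x" "1 *\<^sub>R x = x" "r *\<^sub>R x = complex_of_real r *\<^sub>C x"
    by (transfer; simp add: algebra_simps fun_eq_iff)+
  show "(norm x = 0) = (x = 0)"
    by transfer (simp add: suminf_eq_zero_iff fun_eq_iff)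
  show "norm (x + y) \<le> norm x + norm y"
    by transfer (rule ell2_triangle(2))
  show nC: "norm (c *\<^sub>C x) = cmod c * norm x" for c
    by transfer (simp add: norm_mult power_mult_distrib suminf_mult real_sqrt_mult)
  have "r *\<^sub>R x = complex_of_real r *\<^sub>C x" by (transfer; simp)
  then show "norm (r *\<^sub>R x) = \<bar>r\<bar> * norm x" by (simp add: nC)
qed (simp_all add: dist_ell2_def sgn_ell2_def uniformity_ell2_def open_ell2_def)

end

definition compact_operators :: "(ell2 \<Rightarrow>\<^sub>L ell2) set" where
  "compact_operators =
     {T. clinear_on UNIV (blinfun_apply T) \<and> compact (closure (blinfun_apply T ` cball 0 1))}"


section \<open>Operator spaces\<close>

text \<open>
  An operator space is given by its underlying vector space and the norms on the spaces
  \<open>M\<^sub>n(E)\<close>, to which only the entries \<open>i, j < n\<close> of a matrix \<open>nat \<Rightarrow> nat \<Rightarrow> 'a\<close> contribute.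
  The norms take extended real values only so that suprema need no boundedness side conditions;
  they are finite on all the spaces below.
\<close>

record 'a opspace =
  os_carrier :: "'a set"
  os_norm :: "nat \<Rightarrow> (nat \<Rightarrow> nat \<Rightarrow> 'a) \<Rightarrow> ereal"

text \<open>A subspace of \<open>B(\<ell>\<^sub>2)\<close>, normed by \<open>M\<^sub>n(E) \<subseteq> B(\<ell>\<^sub>2\<^sup>n(\<ell>\<^sub>2))\<close>.\<close>

definition concrete_opspace ::
  "(ell2 \<Rightarrow>\<^sub>L ell2) set \<Rightarrow> (ell2 \<Rightarrow>\<^sub>L ell2) opspace" where
  "concrete_opspace E =
     \<lparr>os_carrier = E,
      os_norm = (\<lambda>n A. SUP x \<in> {x :: nat \<Rightarrow> ell2. L2_set (\<lambda>j. norm (x j)) {..<n} \<le> 1}.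
        ereal (L2_set (\<lambda>i. norm (\<Sum>j<n. blinfun_apply (A i j) (x j))) {..<n}))\<rparr>"

text \<open>A subspace of \<open>M\<^sub>k = B(\<ell>\<^sub>2\<^sup>k)\<close>, normed by \<open>M\<^sub>n(E) \<subseteq> B(\<ell>\<^sub>2\<^sup>n(\<ell>\<^sub>2\<^sup>k))\<close>.\<close>

definition matrix_opspace ::
  "nat \<Rightarrow> (nat \<Rightarrow> nat \<Rightarrow> complex) set \<Rightarrow> (nat \<Rightarrow> nat \<Rightarrow> complex) opspace" where
  "matrix_opspace k E =
     \<lparr>os_carrier = E,
      os_norm = (\<lambda>n A.
        SUP x \<in> {x :: nat \<Rightarrow> nat \<Rightarrow> complex.
                  L2_set (\<lambda>j. L2_set (\<lambda>q. cmod (x j q)) {..<k}) {..<n} \<le> 1}.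
        ereal (L2_set (\<lambda>i. L2_set (\<lambda>p. cmod (\<Sum>j<n. \<Sum>q<k. A i j p q * x j q)) {..<k}) {..<n}))\<rparr>"

definition Mat :: "nat \<Rightarrow> (nat \<Rightarrow> nat \<Rightarrow> complex) opspace" where
  "Mat k = matrix_opspace k {a. \<forall>i j. a i j \<noteq> 0 \<longrightarrow> i < k \<and> j < k}"

definition ell_infty :: "nat \<Rightarrow> (nat \<Rightarrow> nat \<Rightarrow> complex) opspace" where
  "ell_infty n = matrix_opspace n {a. \<forall>i j. a i j \<noteq> 0 \<longrightarrow> i = j \<and> i < n}"

definition cb_norm :: "'a opspace \<Rightarrow> 'b opspace \<Rightarrow> ('a \<Rightarrow> 'b) \<Rightarrow> ereal" where
  "cb_norm E F u =
     (SUP n \<in> {1..}. SUP X \<in> {X. (\<forall>i<n. \<forall>j<n. X i j \<in> os_carrier E) \<and> os_norm E n X \<le> 1}.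
        os_norm F n (\<lambda>i j. u (X i j)))"

text \<open>
  Linear bijections that are not complete isomorphisms contribute \<open>\<infinity>\<close> to the infimum.
\<close>

definition d_cb :: "'a::complex_vector opspace \<Rightarrow> 'b::complex_vector opspace \<Rightarrow> ereal" where
  "d_cb E F =
     (INF u \<in> {u. clinear_on (os_carrier E) u \<and> bij_betw u (os_carrier E) (os_carrier F)}.
        cb_norm E F u * cb_norm F E (inv_into (os_carrier E) u))"

definition d_SK :: "'a::complex_vector opspace \<Rightarrow> ereal" where
  "d_SK E =
     (INF F \<in> {F. csubspace F \<and> closed F \<and> F \<subseteq> compact_operators}. d_cb E (concrete_opspace F))"

text \<open>
  The dual operator space, \<open>M\<^sub>n(E\<^sup>*) = cb(E, M\<^sub>n)\<close>.  Functionals are extended by \<open>0\<close>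
  outside the underlying space of \<open>E\<close>, which makes their representation unique.
\<close>

definition dual_opspace :: "'a::complex_vector opspace \<Rightarrow> ('a \<Rightarrow> complex) opspace" where
  "dual_opspace E =
     \<lparr>os_carrier =
        {\<phi>. clinear_on (os_carrier E) \<phi> \<and> (\<forall>x. x \<notin> os_carrier E \<longrightarrow> \<phi> x = 0) \<and>
            (\<exists>C::real. \<forall>x\<in>os_carrier E. ereal (cmod (\<phi> x)) \<le> ereal C * os_norm E 1 (\<lambda>_ _. x))},
      os_norm = (\<lambda>n \<Phi>. cb_norm E (Mat n) (\<lambda>x i j. if i < n \<and> j < n then \<Phi> i j x else 0))\<rparr>"

definition E1 :: "nat \<Rightarrow> ((nat \<Rightarrow> nat \<Rightarrow> complex) \<Rightarrow> complex) opspace" where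
  "E1 n = dual_opspace (ell_infty n)"

end

theory Submission imports Defs "HOL-Combinatorics.Permutations" begin

text \<open>
  Let \<open>u\<close> be an isomorphism of \<open>E\<^sub>1\<^sup>n\<close> onto a space of compact operators and \<open>a\<^sub>c = u(e\<^sub>c)\<close>. On the
  \<open>n\<close>-regular tree with properly \<open>n\<close>-coloured edges let \<open>z\<^sub>c\<close> be the involution along the edges of
  colour \<open>c\<close>, restricted to a finite ball. The Schur test gives \<open>\<parallel>\<Sum> e\<^sub>c \<otimes> z\<^sub>c\<parallel> \<le> 2\<surd>(n - 1)\<close>, hence
  \<open>\<parallel>\<Sum> a\<^sub>c \<otimes> z\<^sub>c\<parallel> \<le> C = 2\<surd>(n - 1) \<parallel>u\<parallel>\<^sub>c\<^sub>b\<close>.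

  Take a finite \<open>n\<close>-coloured graph of large girth with \<open>N\<close> vertices and permutation matrices \<open>x\<^sub>c\<close>. As
  the \<open>a\<^sub>c\<close> are compact, we may replace them by \<open>k \<times> k\<close> matrices. The moments of
  \<open>X = \<Sum> a\<^sub>c \<otimes> x\<^sub>c\<close> agree with those of the tree up to a high order, so only a small proportion of
  the singular values of \<open>X\<close> exceeds \<open>C + \<epsilon>\<close>. Since \<open>k\<close> is fixed while the girth grows, they are removed
  by a projection \<open>1 \<otimes> e\<close> with \<open>tr e \<ge> (1 - \<delta>) N\<close>, that is \<open>\<parallel>\<Sum> a\<^sub>c \<otimes> x\<^sub>c e\<parallel> \<le> C + \<epsilon>\<close>. On the
  other hand pairing with the \<open>x\<^sub>c\<close> at the maximally entangled vector gives
  \<open>\<parallel>\<Sum> e\<^sub>c \<otimes> x\<^sub>c e\<parallel> \<ge> n tr e / N \<ge> n (1 - \<delta>)\<close>. Hence \<open>n \<le> \<parallel>u\<^sup>-\<^sup>1\<parallel>\<^sub>c\<^sub>b C\<close>.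
\<close>

section \<open>Finite-dimensional complex vectors\<close>

text \<open>Vectors are total functions of which only the values on \<open>S\<close> count, so
  operators may return anything outside \<open>S\<close>. Conjugation is in the first
  argument.\<close>

definition cip :: "'a set \<Rightarrow> ('a \<Rightarrow> complex) \<Rightarrow> ('a \<Rightarrow> complex) \<Rightarrow> complex" where
  "cip S f g = (\<Sum>z\<in>S. cnj (f z) * g z)"

definition cnm :: "'a set \<Rightarrow> ('a \<Rightarrow> complex) \<Rightarrow> real" where
  "cnm S f = L2_set (\<lambda>z. cmod (f z)) S"

lemma cnm_nonneg [simp]: "0 \<le> cnm S f"
  by (simp add: cnm_def)

lemma cnm_power2: "(cnm S f)\<^sup>2 = (\<Sum>z\<in>S. (cmod (f z))\<^sup>2)"
  by (simp add: cnm_def L2_set_def sum_nonneg)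

lemma cip_self: "cip S f f = complex_of_real ((cnm S f)\<^sup>2)"
  unfolding cip_def cnm_power2 of_real_sum
  by (intro sum.cong refl) (metis complex_norm_square mult.commute of_real_power)

lemma cnm_cong: "(\<And>z. z \<in> S \<Longrightarrow> f z = g z) \<Longrightarrow> cnm S f = cnm S g"
  unfolding cnm_def by (intro L2_set_cong) auto

lemma cip_cong:
  "(\<And>z. z \<in> S \<Longrightarrow> f z = f' z) \<Longrightarrow> (\<And>z. z \<in> S \<Longrightarrow> g z = g' z) \<Longrightarrow> cip S f g = cip S f' g'"
  unfolding cip_def by (intro sum.cong) auto

lemma cmod_cip_le: "cmod (cip S f g) \<le> cnm S f * cnm S g"
proof -
  have "cmod (cip S f g) \<le> (\<Sum>z\<in>S. \<bar>cmod (f z)\<bar> * \<bar>cmod (g z)\<bar>)"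
    unfolding cip_def by (rule order_trans[OF norm_sum]) (simp add: norm_mult)
  also have "\<dots> \<le> cnm S f * cnm S g"
    unfolding cnm_def by (rule L2_set_mult_ineq)
  finally show ?thesis .
qed

lemma cnj_cip: "cnj (cip S f g) = cip S g f"
  by (simp add: cip_def cnj_sum mult.commute)

lemma cip_diff_right: "cip S f (\<lambda>z. g z - h z) = cip S f g - cip S f h"
  by (simp add: cip_def algebra_simps sum_subtractf)

lemma cip_sum_right: "cip S f (\<lambda>z. \<Sum>j\<in>J. c j * \<xi> j z) = (\<Sum>j\<in>J. c j * cip S f (\<xi> j))"
  unfolding cip_def sum_distrib_left by (subst sum.swap) (simp add: algebra_simps)

lemma cip_scale_right: "cip S f (\<lambda>z. c * g z) = c * cip S f g"
  by (simp add: cip_def sum_distrib_left algebra_simps)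

lemma cnm_scale: "cnm S (\<lambda>z. c * f z) = cmod c * cnm S f"
  by (simp add: cnm_def norm_mult L2_set_right_distrib)

lemma cnm_eq_0D: "finite S \<Longrightarrow> cnm S f = 0 \<Longrightarrow> z \<in> S \<Longrightarrow> f z = 0"
  by (simp add: cnm_def L2_set_eq_0_iff)

lemma cmod_le_cnm: "finite S \<Longrightarrow> z \<in> S \<Longrightarrow> cmod (f z) \<le> cnm S f"
  unfolding cnm_def using member_le_L2_set[of S z "\<lambda>z. cmod (f z)"] by auto

definition cdelta :: "'a \<Rightarrow> 'a \<Rightarrow> complex" where
  "cdelta w z = (if z = w then 1 else 0)"

lemma cip_cdelta: "finite S \<Longrightarrow> w \<in> S \<Longrightarrow> cip S (cdelta w) f = f w"
  by (simp add: cip_def cdelta_def if_distrib[of cnj] if_distrib[of "\<lambda>x. x * _"] cong: if_cong)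

lemma cnm_cdelta: "finite S \<Longrightarrow> w \<in> S \<Longrightarrow> cnm S (cdelta w) = 1"
proof -
  assume "finite S" "w \<in> S"
  then have "complex_of_real ((cnm S (cdelta w))\<^sup>2) = 1"
    unfolding cip_self[symmetric] by (simp add: cip_cdelta) (simp add: cdelta_def)
  then have "(cnm S (cdelta w))\<^sup>2 = 1" by (simp only: of_real_eq_1_iff)
  then show ?thesis using cnm_nonneg[of S "cdelta w"] by (simp add: power2_eq_1_iff)
qed

definition corthonormal :: "'a set \<Rightarrow> nat \<Rightarrow> (nat \<Rightarrow> 'a \<Rightarrow> complex) \<Rightarrow> bool" where
  "corthonormal S r \<xi> \<longleftrightarrow> (\<forall>i<r. \<forall>j<r. cip S (\<xi> i) (\<xi> j) = (if i = j then 1 else 0))"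

text \<open>The residual \<open>h\<close> is orthogonal to every \<open>\<xi> i\<close>, so its
  squared norm is exactly the difference of the two sides.\<close>

lemma bessel_inequality:
  assumes "corthonormal S r \<xi>"
  shows "(\<Sum>j<r. (cmod (cip S (\<xi> j) g))\<^sup>2) \<le> (cnm S g)\<^sup>2"
proof -
  define c where "c j = cip S (\<xi> j) g" for j
  define h where "h = (\<lambda>z. g z - (\<Sum>j<r. c j * \<xi> j z))"
  have 1: "cip S (\<xi> i) h = 0" if "i < r" for i
  proof -
    have "cip S (\<xi> i) h = c i - (\<Sum>j<r. c j * cip S (\<xi> i) (\<xi> j))"
      unfolding h_def cip_diff_right cip_sum_right c_def ..
    also have "(\<Sum>j<r. c j * cip S (\<xi> i) (\<xi> j)) = (\<Sum>j<r. if j = i then c j else 0)"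
      using assms that by (intro sum.cong) (auto simp: corthonormal_def)
    finally show ?thesis using that by simp
  qed
  have "cip S h h = cip S h g - (\<Sum>j<r. c j * cip S h (\<xi> j))"
    unfolding cip_diff_right[symmetric] cip_sum_right[symmetric] h_def ..
  also have "(\<Sum>j<r. c j * cip S h (\<xi> j)) = 0"
    using 1 by (intro sum.neutral) (auto, metis cnj_cip complex_cnj_zero)
  also have "cip S h g = cnj (cip S g h)" by (simp add: cnj_cip)
  also have "cip S g h = cip S g g - (\<Sum>j<r. c j * cnj (c j))"
    unfolding h_def cip_diff_right cip_sum_right c_def by (simp add: cnj_cip)
  finally have "complex_of_real ((cnm S h)\<^sup>2) = complex_of_real ((cnm S g)\<^sup>2 - (\<Sum>j<r. (cmod (c j))\<^sup>2))"
    by (simp add: cip_self complex_norm_square[symmetric] cnj_sum mult.commute)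
  then have "(cnm S h)\<^sup>2 = (cnm S g)\<^sup>2 - (\<Sum>j<r. (cmod (c j))\<^sup>2)"
    by (simp only: of_real_eq_iff)
  then show ?thesis unfolding c_def by (smt (verit) zero_le_power2)
qed

lemma selfadjoint_funpow:
  assumes "\<And>f g. cip S (M f) g = cip S f (M g)"
  shows "cip S ((M ^^ i) f) g = cip S f ((M ^^ i) g)"
proof (induction i arbitrary: f g)
  case (Suc i)
  show ?case by (simp add: assms Suc) (simp add: funpow_swap1)
qed simp

text \<open>Repeated squaring stands in for the spectral theorem. Self-adjointness turns the squared
  norm of \<open>M^(2^i) \<xi>\<close> into the inner product of \<open>\<xi>\<close> with
  \<open>M^(2^(i+1)) \<xi>\<close>, and Cauchy-Schwarz bounds this by the norm of the next power;
  hence exponents that are powers of two.\<close>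

lemma cnm_funpow_selfadjoint_ge:
  assumes M: "\<And>f g. cip S (M f) g = cip S f (M g)" and "cnm S \<xi> = 1"
    and a: "0 \<le> a" "a \<le> cmod (cip S \<xi> (M \<xi>))"
  shows "a ^ (2 ^ i) \<le> cnm S ((M ^^ (2 ^ i)) \<xi>)"
proof (induction i)
  case 0
  show ?case using a cmod_cip_le[of S \<xi> "M \<xi>"] assms(2) by simp
next
  case (Suc i)
  let ?g = "(M ^^ (2 ^ i)) \<xi>"
  have "a ^ (2 ^ Suc i) = (a ^ (2 ^ i))\<^sup>2"
    by (simp add: power_mult[symmetric] mult.commute)
  also have "\<dots> \<le> (cnm S ?g)\<^sup>2" using Suc a by (intro power_mono) auto
  also have "\<dots> = cmod (cip S ?g ?g)" by (simp add: cip_self norm_power)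
  also have "cip S ?g ?g = cip S \<xi> ((M ^^ (2 ^ Suc i)) \<xi>)"
    by (simp add: selfadjoint_funpow[OF M] mult_2 funpow_add)
  also have "cmod \<dots> \<le> cnm S ((M ^^ (2 ^ Suc i)) \<xi>)"
    using cmod_cip_le[of S \<xi> "(M ^^ (2 ^ Suc i)) \<xi>"] assms(2) by simp
  finally show ?case .
qed

lemma corthonormal_cnm: "corthonormal S r \<xi> \<Longrightarrow> j < r \<Longrightarrow> cnm S (\<xi> j) = 1"
proof -
  assume "corthonormal S r \<xi>" "j < r"
  then have "complex_of_real ((cnm S (\<xi> j))\<^sup>2) = 1"
    unfolding cip_self[symmetric] by (simp add: corthonormal_def)
  then have "(cnm S (\<xi> j))\<^sup>2 = 1" by (simp only: of_real_eq_1_iff)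
  then show ?thesis using cnm_nonneg[of S "\<xi> j"] by (simp add: power2_eq_1_iff)
qed

text \<open>A Markov inequality for eigenvalues, without diagonalising \<open>M\<close>. With
  \<open>A = M^(2^i)\<close>, each \<open>\<xi> j\<close> contributes at least
  \<open>a^(2 * 2^i)\<close> to the squared Hilbert-Schmidt norm of \<open>A\<close>, which is the
  trace of \<open>A^2\<close> and so at most \<open>card S * B\<close>.\<close>

lemma orthonormal_count_trace:
  assumes M: "\<And>f g. cip S (M f) g = cip S f (M g)" and S: "finite S"
    and ort: "corthonormal S r \<xi>"
    and a: "0 \<le> a" "\<And>j. j < r \<Longrightarrow> a \<le> cmod (cip S (\<xi> j) (M (\<xi> j)))"
    and B: "\<And>z. z \<in> S \<Longrightarrow> cmod ((M ^^ (2 * 2 ^ i)) (cdelta z) z) \<le> B"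
  shows "real r * a ^ (2 * 2 ^ i) \<le> real (card S) * B"
proof -
  let ?A = "M ^^ (2 ^ i)"
  have "real r * a ^ (2 * 2 ^ i) = (\<Sum>j<r. (a ^ (2 ^ i))\<^sup>2)"
    by (simp add: power_mult[symmetric] mult.commute)
  also have "\<dots> \<le> (\<Sum>j<r. (cnm S (?A (\<xi> j)))\<^sup>2)"
    using a corthonormal_cnm[OF ort]
    by (intro sum_mono power_mono cnm_funpow_selfadjoint_ge[OF M]) auto
  also have "\<dots> = (\<Sum>z\<in>S. \<Sum>j<r. (cmod (?A (\<xi> j) z))\<^sup>2)"
    unfolding cnm_power2 by (rule sum.swap)
  \<comment> \<open>Moving \<open>A\<close> onto the basis vector at \<open>z\<close> allows
    Bessel's inequality for each fixed \<open>z\<close>.\<close>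
  also have "\<dots> = (\<Sum>z\<in>S. \<Sum>j<r. (cmod (cip S (\<xi> j) (?A (cdelta z))))\<^sup>2)"
  proof (intro sum.cong refl)
    fix z j assume "z \<in> S"
    then have "?A (\<xi> j) z = cip S (cdelta z) (?A (\<xi> j))" by (simp add: cip_cdelta S)
    also have "\<dots> = cip S (?A (cdelta z)) (\<xi> j)" by (simp add: selfadjoint_funpow[OF M])
    finally show "(cmod (?A (\<xi> j) z))\<^sup>2 = (cmod (cip S (\<xi> j) (?A (cdelta z))))\<^sup>2"
      by (metis cnj_cip complex_mod_cnj)
  qed
  also have "\<dots> \<le> (\<Sum>z\<in>S. (cnm S (?A (cdelta z)))\<^sup>2)"
    by (intro sum_mono bessel_inequality ort)
  also have "\<dots> = (\<Sum>z\<in>S. cmod (cip S (cdelta z) ((M ^^ (2 * 2 ^ i)) (cdelta z))))"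
  proof (intro sum.cong refl)
    fix z
    have "(cnm S (?A (cdelta z)))\<^sup>2 = cmod (cip S (?A (cdelta z)) (?A (cdelta z)))"
      by (simp add: cip_self norm_power)
    then show "(cnm S (?A (cdelta z)))\<^sup>2 = cmod (cip S (cdelta z) ((M ^^ (2 * 2 ^ i)) (cdelta z)))"
      by (simp add: selfadjoint_funpow[OF M] mult_2 funpow_add)
  qed
  also have "\<dots> \<le> (\<Sum>z\<in>S. B)"
    using B by (intro sum_mono) (simp add: cip_cdelta S)
  finally show ?thesis by simp
qed

section \<open>Cutting large directions by a projection\<close>

definition mv :: "nat \<Rightarrow> (nat \<Rightarrow> nat \<Rightarrow> complex) \<Rightarrow> (nat \<Rightarrow> complex) \<Rightarrow> nat \<Rightarrow> complex" where
  "mv N a x v = (\<Sum>w<N. a v w * x w)"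

definition mtrace :: "nat \<Rightarrow> (nat \<Rightarrow> nat \<Rightarrow> complex) \<Rightarrow> real" where
  "mtrace N a = Re (\<Sum>v<N. a v v)"

definition hproj :: "nat \<Rightarrow> (nat \<Rightarrow> nat \<Rightarrow> complex) \<Rightarrow> bool" where
  "hproj N e \<longleftrightarrow> (\<forall>v<N. \<forall>w<N. e w v = cnj (e v w) \<and> mv N e (\<lambda>u. e u w) v = e v w)"

text \<open>The matrix identity \<open>d e = d\<close>; between projections it says that the range
  of \<open>d\<close> lies in that of \<open>e\<close>.\<close>

definition msub :: "nat \<Rightarrow> (nat \<Rightarrow> nat \<Rightarrow> complex) \<Rightarrow> (nat \<Rightarrow> nat \<Rightarrow> complex) \<Rightarrow> bool" where
  "msub N d e \<longleftrightarrow> (\<forall>v<N. \<forall>w<N. mv N d (\<lambda>u. e u w) v = d v w)"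

lemma hproj_herm: "hproj N e \<Longrightarrow> v < N \<Longrightarrow> w < N \<Longrightarrow> e w v = cnj (e v w)"
  unfolding hproj_def by blast

lemma hproj_idem: "hproj N e \<Longrightarrow> v < N \<Longrightarrow> w < N \<Longrightarrow> mv N e (\<lambda>u. e u w) v = e v w"
  unfolding hproj_def by blast

lemma mv_cong: "(\<And>w. w < N \<Longrightarrow> x w = y w) \<Longrightarrow> mv N a x v = mv N a y v"
  by (simp add: mv_def)

lemma mv_mv: "mv N a (mv N b x) v = mv N (\<lambda>v w. mv N a (\<lambda>u. b u w) v) x v"
  unfolding mv_def sum_distrib_left sum_distrib_right
  by (subst sum.swap) (simp add: mult.assoc)

lemma msub_mv: "msub N d e \<Longrightarrow> v < N \<Longrightarrow> mv N d (mv N e x) v = mv N d x v"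
  unfolding mv_mv by (simp add: mv_def msub_def)

lemma msub_self: "hproj N e \<Longrightarrow> msub N e e"
  by (simp add: msub_def hproj_idem)

lemma msub_trans:
  assumes "msub N c d" "msub N d e" shows "msub N c e"
  unfolding msub_def
proof (intro allI impI)
  fix v w assume vw: "v < N" "w < N"
  have "mv N c (\<lambda>u. e u w) v = mv N c (mv N d (\<lambda>u. e u w)) v"
    using msub_mv[OF assms(1) vw(1)] by simp
  also have "\<dots> = mv N c (\<lambda>u. d u w) v"
    using assms(2) vw by (intro mv_cong) (simp add: msub_def)
  finally show "mv N c (\<lambda>u. e u w) v = c v w" using assms(1) vw by (simp add: msub_def)
qed

text \<open>With \<open>h = e \<eta>\<close> nonzero, \<open>d\<close> is \<open>e\<close> minus the
  rank one projection onto \<open>h\<close>. As \<open>h\<close> lies in the range of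
  \<open>e\<close>, this is again a projection, below \<open>e\<close> and of trace one less, and
  \<open>d \<eta> = h - h = 0\<close>.\<close>

lemma hproj_kill_vector:
  assumes e: "hproj N e"
  shows "\<exists>d. hproj N d \<and> msub N d e \<and> (\<forall>v<N. mv N d \<eta> v = 0) \<and> mtrace N e - 1 \<le> mtrace N d"
proof (cases "\<forall>v<N. mv N e \<eta> v = 0")
  case True
  then show ?thesis using e msub_self[OF e] by auto
next
  case False
  define h where "h = mv N e \<eta>"
  define H where "H = (\<Sum>v<N. (cmod (h v))\<^sup>2)"
  from False obtain v0 where "v0 < N" "h v0 \<noteq> 0" by (auto simp: h_def)
  then have "0 < (cmod (h v0))\<^sup>2" "v0 \<in> {..<N}" by auto
  then have "H > 0" unfolding H_def by (intro sum_pos2[of _ v0]) auto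
  then have H0: "complex_of_real H \<noteq> 0" by simp
  have hh: "(\<Sum>v<N. h v * cnj (h v)) = of_real H" "(\<Sum>v<N. cnj (h v) * h v) = of_real H"
    by (simp_all add: H_def complex_norm_square[symmetric] mult.commute[of "cnj _"])
  have herm: "e w v = cnj (e v w)" if "v < N" "w < N" for v w
    using hproj_herm[OF e that] .
  have eh: "(\<Sum>u<N. e v u * h u) = h v" if "v < N" for v
    using msub_mv[OF msub_self[OF e] that, of \<eta>] by (simp add: h_def mv_def)
  have he: "(\<Sum>u<N. cnj (h u) * e u w) = cnj (h w)" if "w < N" for w
  proof -
    have "(\<Sum>u<N. cnj (h u) * e u w) = cnj (\<Sum>u<N. e w u * h u)"
      unfolding cnj_sum using that
      by (intro sum.cong refl) (simp add: herm[of w] mult.commute[of "cnj (h _)"])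
    then show ?thesis by (simp add: eh that)
  qed
  have ee: "(\<Sum>u<N. e v u * e u w) = e v w" if "v < N" "w < N" for v w
    using hproj_idem[OF e that] by (simp add: mv_def)
  define d where "d v w = e v w - h v * cnj (h w) / of_real H" for v w
  \<comment> \<open>Against \<open>h\<close>, which is in the range of \<open>e\<close>, the vector
    \<open>\<eta>\<close> may be replaced by \<open>e \<eta> = h\<close>.\<close>
  have "(\<Sum>u<N. cnj (h u) * \<eta> u) = (\<Sum>u<N. (\<Sum>w<N. cnj (h w) * e w u) * \<eta> u)"
    by (simp add: he)
  also have "\<dots> = (\<Sum>w<N. cnj (h w) * h w)"
    unfolding h_def mv_def sum_distrib_left sum_distrib_right
    by (subst sum.swap) (simp add: mult.assoc)
  finally have h\<eta>: "(\<Sum>u<N. cnj (h u) * \<eta> u) = of_real H" by (simp add: hh)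
  have de: "mv N d (\<lambda>u. e u w) v = d v w" if "v < N" "w < N" for v w
  proof -
    have "mv N d (\<lambda>u. e u w) v = (\<Sum>u<N. e v u * e u w - h v / of_real H * (cnj (h u) * e u w))"
      unfolding mv_def d_def by (simp add: algebra_simps)
    also have "\<dots> = d v w"
      unfolding sum_subtractf sum_distrib_left[symmetric] using that by (simp add: ee he d_def)
    finally show ?thesis .
  qed
  have dh: "mv N d h v = 0" if "v < N" for v
  proof -
    have "mv N d h v = (\<Sum>u<N. e v u * h u - h v / of_real H * (cnj (h u) * h u))"
      unfolding mv_def d_def by (simp add: algebra_simps)
    also have "\<dots> = 0"
      unfolding sum_subtractf sum_distrib_left[symmetric] using that H0 by (simp add: eh hh)
    finally show ?thesis .
  qed
  have dd: "mv N d (\<lambda>u. d u w) v = d v w" if "v < N" "w < N" for v w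
  proof -
    have "mv N d (\<lambda>u. d u w) v = mv N d (\<lambda>u. e u w) v - mv N d h v * (cnj (h w) / of_real H)"
      unfolding mv_def sum_distrib_right sum_subtractf[symmetric]
      by (intro sum.cong refl) (simp add: d_def algebra_simps)
    then show ?thesis using that by (simp add: de dh)
  qed
  have "hproj N d"
    unfolding hproj_def
  proof (intro allI impI conjI dd)
    fix v w assume "v < N" "w < N"
    then show "d w v = cnj (d v w)" by (simp add: d_def herm[of v w] mult.commute)
  qed
  moreover have "msub N d e" using de by (simp add: msub_def)
  moreover have "mv N d \<eta> v = 0" if "v < N" for v
  proof -
    have "mv N d \<eta> v = (\<Sum>u<N. e v u * \<eta> u - h v / of_real H * (cnj (h u) * \<eta> u))"
      unfolding mv_def d_def by (simp add: algebra_simps)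
    also have "\<dots> = 0"
      unfolding sum_subtractf sum_distrib_left[symmetric] using that H0
      by (simp add: h\<eta>) (simp add: h_def mv_def)
    finally show ?thesis .
  qed
  moreover have "mtrace N d = mtrace N e - 1"
  proof -
    have "(\<Sum>v<N. d v v) = (\<Sum>v<N. e v v) - 1"
      unfolding d_def sum_subtractf sum_divide_distrib[symmetric] hh using H0 by simp
    then show ?thesis by (simp add: mtrace_def)
  qed
  ultimately show ?thesis by (metis order_refl)
qed

text \<open>Vectors killed earlier stay killed, since \<open>c d = c\<close> for the next projection
  \<open>c\<close>.\<close>

lemma hproj_kill_vectors:
  assumes e: "hproj N e"
  shows "\<exists>d. hproj N d \<and> msub N d e \<and> (\<forall>p<k. \<forall>v<N. mv N d (\<eta> p) v = 0) \<and>
           mtrace N e - real k \<le> mtrace N d"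
proof (induction k)
  case 0
  then show ?case using e msub_self[OF e] by auto
next
  case (Suc k)
  then obtain d where d: "hproj N d" "msub N d e" "\<And>p v. p < k \<Longrightarrow> v < N \<Longrightarrow> mv N d (\<eta> p) v = 0"
    "mtrace N e - real k \<le> mtrace N d" by blast
  obtain c where c: "hproj N c" "msub N c d" "\<And>v. v < N \<Longrightarrow> mv N c (\<eta> k) v = 0"
    "mtrace N d - 1 \<le> mtrace N c" using hproj_kill_vector[OF d(1)] by blast
  have "mv N c (\<eta> p) v = 0" if "p < Suc k" "v < N" for p v
  proof (cases "p = k")
    case False
    then have "mv N c (\<eta> p) v = mv N c (mv N d (\<eta> p)) v" using msub_mv[OF c(2) that(2)] by simp
    also have "\<dots> = mv N c (\<lambda>_. 0) v" using False that by (intro mv_cong d(3)) auto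
    finally show ?thesis by (simp add: mv_def)
  qed (use c that in auto)
  moreover have "mtrace N e - real (Suc k) \<le> mtrace N c" using c d by simp
  ultimately show ?case using c msub_trans[OF c(2) d(2)] by blast
qed

text \<open>The operator \<open>1 \<otimes> e\<close>; in a pair \<open>(p, v)\<close> the second
  component is the one on which \<open>e\<close> acts.\<close>

definition amp :: "nat \<Rightarrow> (nat \<Rightarrow> nat \<Rightarrow> complex) \<Rightarrow> (nat \<times> nat \<Rightarrow> complex) \<Rightarrow> nat \<times> nat \<Rightarrow> complex" where
  "amp N e f = (\<lambda>(p, v). mv N e (\<lambda>w. f (p, w)) v)"

lemma cip_prod: "cip (A \<times> B) f g = (\<Sum>p\<in>A. \<Sum>v\<in>B. cnj (f (p, v)) * g (p, v))"
  unfolding cip_def by (rule sum.cartesian_product')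

lemma cip_amp:
  assumes "hproj N e"
  shows "cip ({..<k} \<times> {..<N}) (amp N e f) g = cip ({..<k} \<times> {..<N}) f (amp N e g)"
proof -
  have "(\<Sum>v<N. cnj (mv N e (\<lambda>w. f (p, w)) v) * g (p, v)) =
        (\<Sum>v<N. cnj (f (p, v)) * mv N e (\<lambda>w. g (p, w)) v)" for p
  proof -
    have "(\<Sum>v<N. cnj (mv N e (\<lambda>w. f (p, w)) v) * g (p, v)) =
          (\<Sum>v<N. \<Sum>w<N. cnj (f (p, w)) * (e w v * g (p, v)))"
      unfolding mv_def cnj_sum sum_distrib_right
    proof (intro sum.cong refl)
      fix v w assume "v \<in> {..<N}" "w \<in> {..<N}"
      then show "cnj (e v w * f (p, w)) * g (p, v) = cnj (f (p, w)) * (e w v * g (p, v))"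
        by (simp add: hproj_herm[OF assms, of v w])
    qed
    also have "\<dots> = (\<Sum>w<N. \<Sum>v<N. cnj (f (p, w)) * (e w v * g (p, v)))" by (rule sum.swap)
    finally show ?thesis by (simp add: mv_def sum_distrib_left)
  qed
  then show ?thesis
    by (simp only: cip_prod amp_def prod.case)
qed

lemma amp_amp:
  assumes "hproj N e" "v < N"
  shows "amp N e (amp N e f) (p, v) = amp N e f (p, v)"
  using msub_mv[OF msub_self[OF assms(1)] assms(2), of "\<lambda>w. f (p, w)"] by (simp add: amp_def)

text \<open>As \<open>1 \<otimes> e\<close> is self-adjoint and idempotent, the squared norm of the
  image of \<open>f\<close> is the inner product of \<open>f\<close> with it; Cauchy-Schwarz and
  cancellation finish.\<close>

lemma cnm_amp_le:
  assumes "hproj N e"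
  shows "cnm ({..<k} \<times> {..<N}) (amp N e f) \<le> cnm ({..<k} \<times> {..<N}) f"
proof -
  let ?S = "{..<k} \<times> {..<N}"
  have "cip ?S (amp N e f) (amp N e f) = cip ?S f (amp N e (amp N e f))" by (rule cip_amp[OF assms])
  also have "\<dots> = cip ?S f (amp N e f)" using amp_amp[OF assms] by (intro cip_cong) auto
  finally have "(cnm ?S (amp N e f))\<^sup>2 = cmod (cip ?S f (amp N e f))"
    by (metis cip_self norm_of_real abs_power2)
  also have "\<dots> \<le> cnm ?S f * cnm ?S (amp N e f)" by (rule cmod_cip_le)
  finally have "cnm ?S (amp N e f) * cnm ?S (amp N e f) \<le> cnm ?S f * cnm ?S (amp N e f)"
    by (simp add: power2_eq_square)
  then show ?thesis
    using cnm_nonneg[of ?S f] cnm_nonneg[of ?S "amp N e f"]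
    by (smt (verit, best) mult_le_cancel_right)
qed

text \<open>
  The finite dimension \<open>k\<close> enters here: a vector of \<open>\<complex>\<^sup>k \<otimes> \<complex>\<^sup>N\<close> lies in \<open>\<complex>\<^sup>k \<otimes> V\<close> with
  \<open>dim V \<le> k\<close>, so removing the directions on which \<open>L\<close> is large costs at most \<open>k\<close> dimensions
  of \<open>\<complex>\<^sup>N\<close> for each of them.
\<close>

lemma projection_cutting_large_directions:
  fixes L :: "(nat \<times> nat \<Rightarrow> complex) \<Rightarrow> real"
  defines "S \<equiv> \<lambda>k N. {..<k} \<times> {..<N}"
  assumes cong: "\<And>f g. (\<And>z. z \<in> S k N \<Longrightarrow> f z = g z) \<Longrightarrow> L f = L g"
    and scale: "\<And>c f. L (\<lambda>z. c * f z) = cmod c * L f"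
    and c: "0 \<le> c"
    and count: "\<And>r \<xi>. corthonormal (S k N) r \<xi> \<Longrightarrow> (\<And>j. j < r \<Longrightarrow> c < L (\<xi> j)) \<Longrightarrow> real r \<le> B"
  shows "\<exists>e. hproj N e \<and> real N - real k * B \<le> mtrace N e \<and>
           (\<forall>f. L (amp N e f) \<le> c * cnm (S k N) f)"
proof -
  \<comment> \<open>\<open>P r\<close> describes a greedy choice after \<open>r\<close> rounds:
    \<open>r\<close> orthonormal vectors on which \<open>L\<close> exceeds \<open>c\<close> have
    been annihilated, at a price of at most \<open>k\<close> dimensions each. The hypothesis
    \<open>count\<close> bounds the number of rounds, and the projection at which the choice cannot
    continue is the desired one.\<close>
  define P where "P r \<longleftrightarrow> (\<exists>e \<xi>. hproj N e \<and> real N - real k * real r \<le> mtrace N e \<and>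
     corthonormal (S k N) r \<xi> \<and> (\<forall>j<r. c < L (\<xi> j)) \<and>
     (\<forall>j<r. \<forall>z\<in>S k N. amp N e (\<xi> j) z = 0))" for r
  have fin: "finite (S k N)" by (simp add: S_def)
  define I where "I = (\<lambda>v w::nat. if v = w then (1::complex) else 0)"
  have mvI: "mv N I x v = x v" if "v < N" for x v
    using that by (simp add: mv_def I_def if_distrib[of "\<lambda>x. x * _"] cong: if_cong)
  have "hproj N I" "mtrace N I = real N"
    unfolding hproj_def by (simp_all add: mvI) (simp_all add: I_def mtrace_def)
  then have "P 0" unfolding P_def by (auto simp: corthonormal_def intro!: exI[of _ I])
  moreover have "\<not> P (Suc (nat \<lfloor>\<bar>B\<bar>\<rfloor>))"
  proof
    assume "P (Suc (nat \<lfloor>\<bar>B\<bar>\<rfloor>))"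
    then have "real (Suc (nat \<lfloor>\<bar>B\<bar>\<rfloor>)) \<le> B" using count unfolding P_def by blast
    then show False by linarith
  qed
  ultimately obtain r where r: "P r" "\<not> P (Suc r)" by (metis nat_induct)
  then obtain e \<xi> where e: "hproj N e" "real N - real k * real r \<le> mtrace N e"
    and \<xi>: "corthonormal (S k N) r \<xi>" "\<And>j. j < r \<Longrightarrow> c < L (\<xi> j)"
      "\<And>j z. j < r \<Longrightarrow> z \<in> S k N \<Longrightarrow> amp N e (\<xi> j) z = 0"
    unfolding P_def by blast
  have "L (amp N e f) \<le> c * cnm (S k N) f" for f
  proof (rule ccontr)
    assume "\<not> L (amp N e f) \<le> c * cnm (S k N) f"
    then have large: "c * cnm (S k N) f < L (amp N e f)" by simp
    define g where "g = amp N e f"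
    have gf: "cnm (S k N) g \<le> cnm (S k N) f" unfolding g_def S_def by (rule cnm_amp_le[OF e(1)])
    then have Lg: "c * cnm (S k N) g < L g" using large c unfolding g_def
      by (meson mult_left_mono order.strict_trans1)
    have g0: "cnm (S k N) g > 0"
    proof (rule ccontr)
      assume "\<not> cnm (S k N) g > 0"
      then have "cnm (S k N) g = 0" using cnm_nonneg[of "S k N" g] by linarith
      then have "L g = L (\<lambda>z. 0 * g z)" using cnm_eq_0D[OF fin] by (intro cong) auto
      also have "\<dots> = 0" unfolding scale by simp
      finally show False using Lg c cnm_nonneg[of "S k N" g]
        by (metis mult_nonneg_nonneg not_less)
    qed
    define t where "t = complex_of_real (1 / cnm (S k N) g)"
    define \<zeta> where "\<zeta> = (\<lambda>z. t * g z)"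
    have \<zeta>1: "cip (S k N) \<zeta> \<zeta> = 1"
    proof -
      have "cmod t * cnm (S k N) g = 1" using g0 by (simp add: t_def norm_divide)
      then show ?thesis unfolding cip_self \<zeta>_def cnm_scale by simp
    qed
    have "L \<zeta> = L g / cnm (S k N) g"
      unfolding \<zeta>_def scale t_def using g0 by (simp add: norm_divide)
    then have L\<zeta>: "c < L \<zeta>" using Lg g0 by (simp add: pos_less_divide_eq)
    \<comment> \<open>\<open>\<zeta>\<close> lies in the range of the self-adjoint
      \<open>amp N e\<close>, which annihilates \<open>\<xi> j\<close>.\<close>
    have ort: "cip (S k N) (\<xi> j) \<zeta> = 0" if "j < r" for j
    proof -
      have "cip (S k N) (\<xi> j) g = cip (S k N) (amp N e (\<xi> j)) f"
        unfolding g_def S_def by (rule cip_amp[OF e(1), symmetric])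
      also have "\<dots> = 0" using \<xi>(3) that by (simp add: cip_def)
      finally show ?thesis by (simp add: \<zeta>_def cip_scale_right)
    qed
    then have ort': "cip (S k N) \<zeta> (\<xi> j) = 0" if "j < r" for j
      using that by (metis cnj_cip complex_cnj_zero)
    \<comment> \<open>Killing the \<open>k\<close> slices of \<open>\<zeta>\<close> with fixed first
      coordinate makes \<open>1 \<otimes> d\<close> annihilate \<open>\<zeta>\<close>.\<close>
    obtain d where d: "hproj N d" "msub N d e"
      "\<And>p v. p < k \<Longrightarrow> v < N \<Longrightarrow> mv N d (\<lambda>w. \<zeta> (p, w)) v = 0"
      "mtrace N e - real k \<le> mtrace N d"
      using hproj_kill_vectors[OF e(1), of k "\<lambda>p w. \<zeta> (p, w)"] by blast
    define \<xi>' where "\<xi>' = \<xi>(r := \<zeta>)"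
    have "corthonormal (S k N) (Suc r) \<xi>'"
      unfolding corthonormal_def \<xi>'_def using \<xi>(1) ort ort' \<zeta>1
      by (auto simp: less_Suc_eq corthonormal_def)
    moreover have "c < L (\<xi>' j)" if "j < Suc r" for j
      using that \<xi>(2) L\<zeta> by (auto simp: \<xi>'_def less_Suc_eq)
    moreover have "amp N d (\<xi>' j) z = 0" if j: "j < Suc r" and z: "z \<in> S k N" for j z
    proof -
      obtain p v where z': "z = (p, v)" "p < k" "v < N" using z by (auto simp: S_def)
      show ?thesis
      proof (cases "j = r")
        case True
        then show ?thesis using d(3) z' by (simp add: \<xi>'_def amp_def)
      next
        case False
        then have "j < r" using j by simp
        have "amp N d (\<xi> j) z = mv N d (mv N e (\<lambda>w. \<xi> j (p, w))) v"
          using msub_mv[OF d(2) z'(3)] z' by (simp add: amp_def)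
        also have "\<dots> = mv N d (\<lambda>_. 0) v"
          using \<xi>(3)[OF \<open>j < r\<close>] z' by (intro mv_cong) (auto simp: amp_def S_def)
        finally show ?thesis using False by (simp add: mv_def \<xi>'_def)
      qed
    qed
    moreover have "real N - real k * real (Suc r) \<le> mtrace N d"
      using d(4) e(2) by (simp add: algebra_simps)
    ultimately have "P (Suc r)" unfolding P_def using d(1) by blast
    then show False using r by simp
  qed
  moreover have "real N - real k * B \<le> mtrace N e"
    using e(2) mult_left_mono[OF count[OF \<xi>(1,2)], of "real k"] by simp
  ultimately show ?thesis using e(1) by blast
qed

section \<open>Finite graphs that are locally trees\<close>

definition partial_involutions ::
  "nat \<Rightarrow> nat \<Rightarrow> (nat \<Rightarrow> nat \<Rightarrow> bool) \<Rightarrow> (nat \<Rightarrow> nat \<Rightarrow> nat) \<Rightarrow> bool" where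
  "partial_involutions n m act tau \<longleftrightarrow>
     (\<forall>c<n. \<forall>s<m. act c s \<longrightarrow> tau c s < m \<and> act c (tau c s) \<and> tau c (tau c s) = s)"

text \<open>Intended model: \<open>s < m\<close> enumerates a ball of radius \<open>R\<close> in the
  n-regular tree, \<open>tau c\<close> follows the edge of colour \<open>c\<close> where
  \<open>act c s\<close> says that it stays in the ball, and \<open>lev\<close> is the distance from
  the root. \<open>Phi v\<close> maps the ball into the finite graph with edge involutions
  \<open>sig\<close>, sending the root to \<open>v\<close>. Large girth appears as the condition
  that no other vertex of the ball goes to \<open>v\<close>, and \<open>h\<close> is a positive
  supersolution for the adjacency operator of the ball.\<close>

locale tree_covering =
  fixes n R m N root :: nat and act :: "nat \<Rightarrow> nat \<Rightarrow> bool" and tau sig :: "nat \<Rightarrow> nat \<Rightarrow> nat"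
    and h :: "nat \<Rightarrow> real" and lev :: "nat \<Rightarrow> nat" and Phi :: "nat \<Rightarrow> nat \<Rightarrow> nat"
  assumes N_pos: "0 < N"
    and tau: "partial_involutions n m act tau"
    and sig: "partial_involutions n N (\<lambda>_ _. True) sig"
    and root: "root < m" "lev root = 0"
    and h_pos: "s < m \<Longrightarrow> 0 < h s"
    and h_sum: "s < m \<Longrightarrow> (\<Sum>c | c < n \<and> act c s. h (tau c s)) \<le> 2 * sqrt (real n - 1) * h s"
    and act: "s < m \<Longrightarrow> lev s < R \<Longrightarrow> c < n \<Longrightarrow> act c s"
    and lev: "s < m \<Longrightarrow> c < n \<Longrightarrow> act c s \<Longrightarrow> lev (tau c s) \<le> Suc (lev s)"
    and Phi: "v < N \<Longrightarrow> s < m \<Longrightarrow> Phi v s < N"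
      "v < N \<Longrightarrow> Phi v root = v"
      "v < N \<Longrightarrow> s < m \<Longrightarrow> Phi v s = v \<Longrightarrow> s = root"
      "v < N \<Longrightarrow> s < m \<Longrightarrow> c < n \<Longrightarrow> act c s \<Longrightarrow> Phi v (tau c s) = sig c (Phi v s)"

section \<open>Reduced words and a finite permutation model of the tree\<close>

definition red_words :: "nat \<Rightarrow> nat \<Rightarrow> nat list set" where
  "red_words n R = {s. set s \<subseteq> {..<n} \<and> distinct_adj s \<and> length s \<le> R}"

text \<open>Left multiplication by the generator \<open>c\<close> in the free product of
  \<open>n\<close> copies of Z/2. Its elements are the words without equal neighbours, and its
  Cayley graph is the n-regular tree.\<close>

definition flip :: "nat \<Rightarrow> nat list \<Rightarrow> nat list" where
  "flip c s = (if s \<noteq> [] \<and> hd s = c then tl s else c # s)"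

text \<open>Multiplication by \<open>c\<close> where it stays in the ball and the identity
  elsewhere, which makes every generator an involution of a finite set.\<close>

definition stepw :: "nat \<Rightarrow> nat \<Rightarrow> nat \<Rightarrow> nat list \<Rightarrow> nat list" where
  "stepw n R c s = (if s \<in> red_words n R \<and> flip c s \<in> red_words n R then flip c s else s)"

text \<open>The word acts on permutations \<open>v\<close> of the ball by composition from the left;
  these permutations become the vertices of the finite graph.\<close>

fun act_word :: "nat \<Rightarrow> nat \<Rightarrow> (nat list \<Rightarrow> nat list) \<Rightarrow> nat list \<Rightarrow> nat list \<Rightarrow> nat list" where
  "act_word n R v [] = v"
| "act_word n R v (c # s) = stepw n R c \<circ> act_word n R v s"

lemma finite_red_words: "finite (red_words n R)"
  by (rule finite_subset[OF _ finite_lists_length_le[of "{..<n}" R]]) (auto simp: red_words_def)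

lemma flip_flip: "distinct_adj s \<Longrightarrow> flip c (flip c s) = s"
  by (cases s) (auto simp: flip_def distinct_adj_Cons)

lemma stepw_stepw: "stepw n R c (stepw n R c s) = s"
  by (auto simp: stepw_def red_words_def flip_flip)

lemma stepw_permutes: "stepw n R c permutes red_words n R"
proof (rule bij_imp_permutes)
  show "bij_betw (stepw n R c) (red_words n R) (red_words n R)"
    by (rule bij_betw_byWitness[where f' = "stepw n R c"]) (auto simp: stepw_stepw, auto simp: stepw_def)
qed (simp add: stepw_def)

lemma act_word_permutes:
  "v permutes red_words n R \<Longrightarrow> act_word n R v s permutes red_words n R"
  by (induction s) (auto intro: permutes_compose stepw_permutes simp del: o_apply)

lemma act_word_eq: "act_word n R v s = act_word n R id s \<circ> v"
  by (induction s) (simp_all add: comp_assoc)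

text \<open>All suffixes of \<open>s\<close> lie in the ball, so no step is blocked on the way from
  the empty word to \<open>s\<close>. This is the residual finiteness behind the large
  girth.\<close>

lemma act_word_id_Nil: "s \<in> red_words n R \<Longrightarrow> act_word n R id s [] = s"
proof (induction s)
  case (Cons c s)
  then have "s \<in> red_words n R" "flip c s = c # s"
    by (auto simp: red_words_def distinct_adj_Cons flip_def)
  with Cons show ?case by (simp add: stepw_def)
qed simp

text \<open>Evaluate at the point \<open>x\<close> that \<open>v\<close> sends to the empty word:
  acting with \<open>s\<close> carries the value to \<open>s\<close>, yet by assumption it does not
  change.\<close>

lemma act_word_eq_self:
  assumes v: "v permutes red_words n R" and s: "s \<in> red_words n R" and eq: "act_word n R v s = v"
  shows "s = []"
proof -
  obtain x where x: "v x = []" using permutes_surj[OF v] by (metis surjD)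
  have "s = act_word n R id s (v x)" using act_word_id_Nil[OF s] x by simp
  also have "\<dots> = act_word n R v s x" by (subst (2) act_word_eq) simp
  finally show ?thesis using x eq by simp
qed

text \<open>If \<open>flip\<close> cancels the first letter, the claim rests on \<open>stepw\<close>
  being an involution on all words, also where it is blocked.\<close>

lemma act_word_flip:
  assumes "s \<in> red_words n R" "flip c s \<in> red_words n R"
  shows "act_word n R v (flip c s) = stepw n R c \<circ> act_word n R v s"
  by (cases s) (auto simp: flip_def fun_eq_iff stepw_stepw)

lemma flip_in_red_words:
  "s \<in> red_words n R \<Longrightarrow> c < n \<Longrightarrow> length s < R \<Longrightarrow> flip c s \<in> red_words n R"
  by (cases s) (auto simp: red_words_def flip_def distinct_adj_Cons)

lemma length_flip: "length (flip c s) \<le> Suc (length s)"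
  by (auto simp: flip_def)

text \<open>
  The weight \<open>(n - 1)\<^sup>-\<^sup>l\<^sup>/\<^sup>2\<close> at distance \<open>l\<close> from the root is a supersolution for the adjacency
  operator of the \<open>n\<close>-regular tree at its spectral radius.
\<close>

lemma tree_weight_sum:
  assumes n: "2 \<le> n"
  defines "x \<equiv> 1 / sqrt (real n - 1)"
  assumes s: "s \<in> red_words n R"
  shows "(\<Sum>c | c < n \<and> flip c s \<in> red_words n R. x ^ length (flip c s))
           \<le> 2 * sqrt (real n - 1) * x ^ length s"
proof -
  have q: "sqrt (real n - 1) > 0" "real n - 1 > 0" using n by auto
  then have x0: "x > 0" by (simp add: x_def)
  have xx: "x * x = 1 / (real n - 1)" "sqrt (real n - 1) * x = 1"
    using q by (auto simp: x_def)
  have "(\<Sum>c | c < n \<and> flip c s \<in> red_words n R. x ^ length (flip c s))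
          \<le> (\<Sum>c<n. x ^ length (flip c s))"
    using x0 by (intro sum_mono2) auto
  also have "\<dots> \<le> 2 * sqrt (real n - 1) * x ^ length s"
  proof (cases s)
    case Nil
    \<comment> \<open>The root has \<open>n\<close> neighbours, all farther out, and
      \<open>n \<le> 2 * (n - 1)\<close> since \<open>n \<ge> 2\<close>.\<close>
    have "real n * x \<le> 2 * (real n - 1) * x" using n x0 by (intro mult_right_mono) auto
    also have "\<dots> = 2 * (sqrt (real n - 1) * sqrt (real n - 1)) * x"
      using q(2) by (simp only: real_sqrt_mult_self abs_of_pos)
    also have "\<dots> = 2 * sqrt (real n - 1) * (sqrt (real n - 1) * x)"
      by (simp only: mult.assoc)
    finally show ?thesis using Nil xx by (simp add: flip_def)
  next
    case (Cons a t)
    then have a: "a \<in> {..<n}" using s by (auto simp: red_words_def)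
    \<comment> \<open>One neighbour is nearer to the root and \<open>n - 1\<close> are farther away;
      as \<open>(n - 1) * x^2 = 1\<close>, either group contributes
      \<open>x ^ length t\<close>.\<close>
    have "(\<Sum>c<n. x ^ length (flip c s)) =
            x ^ length (flip a s) + (\<Sum>c\<in>{..<n} - {a}. x ^ length (flip c s))"
      using a by (intro sum.remove) auto
    also have "(\<Sum>c\<in>{..<n} - {a}. x ^ length (flip c s)) = (\<Sum>c\<in>{..<n} - {a}. x ^ (length t + 2))"
      using Cons by (intro sum.cong) (auto simp: flip_def)
    also have "\<dots> = (real n - 1) * (x * x) * x ^ length t"
      using a n by (simp add: card_Diff_singleton of_nat_diff)
    also have "\<dots> = x ^ length t" using q by (simp add: xx)
    also have "x ^ length (flip a s) = x ^ length t" using Cons by (simp add: flip_def)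
    also have "x ^ length t + x ^ length t = 2 * (sqrt (real n - 1) * x) * x ^ length t"
      by (simp add: xx)
    finally show ?thesis using Cons by (simp add: mult_ac)
  qed
  finally show ?thesis .
qed

text \<open>The vertices of the finite graph are all permutations of the ball, its edges are given
  by composition with \<open>stepw\<close>, and the covering map at \<open>v\<close> sends a word to
  the result of its action on \<open>v\<close>. The bijections \<open>f\<close> and \<open>g\<close>
  only translate words and permutations into numbers.\<close>

lemma ex_tree_covering:
  assumes n: "2 \<le> n"
  shows "\<exists>m N root act tau sig h lev Phi. tree_covering n R m N root act tau sig h lev Phi"
proof -
  let ?W = "red_words n R" and ?G = "{v. v permutes red_words n R}"
  obtain f where f: "bij_betw f {0..<card ?W} ?W" using ex_bij_betw_nat_finite[OF finite_red_words] by blast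
  have "finite ?G" by (rule finite_permutations[OF finite_red_words])
  then obtain g where g: "bij_betw g {0..<card ?G} ?G" using ex_bij_betw_nat_finite by blast
  define m N where "m = card ?W" and "N = card ?G"
  define fi gi where "fi = inv_into {0..<m} f" and "gi = inv_into {0..<N} g"
  have f1: "f s \<in> ?W" if "s < m" for s
    using f that by (auto simp: m_def bij_betw_def)
  have f2: "fi w < m" "f (fi w) = w" if "w \<in> ?W" for w
    using bij_betw_inv_into_right[OF f that] bij_betw_apply[OF bij_betw_inv_into[OF f] that]
    by (auto simp: fi_def m_def)
  have f3: "fi (f s) = s" if "s < m" for s
    using bij_betw_inv_into_left[OF f] that by (auto simp: fi_def m_def)
  have g1: "g s permutes ?W" if "s < N" for s
    using g that by (auto simp: N_def bij_betw_def)
  have g2: "gi w < N" "g (gi w) = w" if "w permutes ?W" for w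
    using bij_betw_inv_into_right[OF g] bij_betw_apply[OF bij_betw_inv_into[OF g]] that
    by (auto simp: gi_def N_def)
  have g3: "gi (g s) = s" if "s < N" for s
    using bij_betw_inv_into_left[OF g] that by (auto simp: gi_def N_def)
  define act where "act c s \<longleftrightarrow> flip c (f s) \<in> ?W" for c s
  define tau where "tau c s = fi (flip c (f s))" for c s
  define sig where "sig c v = gi (stepw n R c \<circ> g v)" for c v
  define h where "h s = (1 / sqrt (real n - 1)) ^ length (f s)" for s
  define lev where "lev s = length (f s)" for s
  define Phi where "Phi v s = gi (act_word n R (g v) (f s))" for v s
  define root where "root = fi []"
  have nil: "[] \<in> ?W" by (simp add: red_words_def)
  have f_tau: "f (tau c s) = flip c (f s)" "tau c s < m" if "s < m" "act c s" for c s
    using f2 that by (auto simp: act_def tau_def)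
  have g_sig: "g (sig c v) = stepw n R c \<circ> g v" "sig c v < N" if "v < N" for c v
    using g2 permutes_compose[OF g1[OF that] stepw_permutes] by (auto simp: sig_def)
  have g_Phi: "g (Phi v s) = act_word n R (g v) (f s)" "Phi v s < N" if "v < N" "s < m" for v s
    using g2 act_word_permutes[OF g1[OF that(1)]] by (auto simp: Phi_def)
  have "tree_covering n R m N root act tau sig h lev Phi"
  proof
    show "0 < N" using g2(1)[OF permutes_id] by simp
    show "partial_involutions n m act tau"
      unfolding partial_involutions_def
    proof (intro allI impI)
      fix c s assume a: "c < n" "s < m" "act c s"
      have "flip c (f (tau c s)) = f s"
        using f1[OF a(2)] f_tau[OF a(2,3)] by (simp add: flip_flip red_words_def)
      then show "tau c s < m \<and> act c (tau c s) \<and> tau c (tau c s) = s"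
        using f_tau[OF a(2,3)] f1[OF a(2)] f3[OF a(2)] by (simp add: act_def tau_def)
    qed
    show "partial_involutions n N (\<lambda>_ _. True) sig"
      unfolding partial_involutions_def
    proof (intro allI impI conjI TrueI)
      fix c v assume "v < N"
      then show "sig c v < N" "sig c (sig c v) = v"
        using g_sig g3 by (auto simp: sig_def[of c "sig c v"] comp_assoc[symmetric] fun_eq_iff)
          (metis (no_types, lifting) comp_apply ext g3 stepw_stepw)
    qed
    show "root < m" "lev root = 0" using f2[OF nil] by (auto simp: root_def lev_def)
    show "0 < h s" if "s < m" for s using n by (simp add: h_def)
    show "(\<Sum>c | c < n \<and> act c s. h (tau c s)) \<le> 2 * sqrt (real n - 1) * h s" if "s < m" for s
    proof -
      have "(\<Sum>c | c < n \<and> act c s. h (tau c s)) =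
        (\<Sum>c | c < n \<and> flip c (f s) \<in> ?W. (1 / sqrt (real n - 1)) ^ length (flip c (f s)))"
        using that f_tau by (intro sum.cong) (auto simp: h_def act_def)
      also have "\<dots> \<le> 2 * sqrt (real n - 1) * h s"
        unfolding h_def by (rule tree_weight_sum[OF n f1[OF that]])
      finally show ?thesis .
    qed
    show "act c s" if "s < m" "lev s < R" "c < n" for c s
      using flip_in_red_words[OF f1[OF that(1)] that(3)] that by (simp add: act_def lev_def)
    show "lev (tau c s) \<le> Suc (lev s)" if "s < m" "c < n" "act c s" for c s
      using f_tau[OF that(1,3)] length_flip by (simp add: lev_def)
    show "Phi v s < N" if "v < N" "s < m" for v s using g_Phi that by blast
    show "Phi v root = v" if "v < N" for v
      using f2[OF nil] g3[OF that] by (simp add: Phi_def root_def)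
    show "s = root" if "v < N" "s < m" "Phi v s = v" for v s
    proof -
      have "f s = []"
        using act_word_eq_self[OF g1[OF that(1)] f1[OF that(2)]] g_Phi[OF that(1,2)] that(3) by simp
      then show ?thesis using f3[OF that(2)] by (simp add: root_def)
    qed
    show "Phi v (tau c s) = sig c (Phi v s)" if "v < N" "s < m" "c < n" "act c s" for v c s
    proof -
      have "Phi v (tau c s) = gi (stepw n R c \<circ> act_word n R (g v) (f s))"
        using act_word_flip[OF f1[OF that(2)], of c "g v"] f_tau[OF that(2,4)] that(4)
        by (simp add: Phi_def act_def)
      then show ?thesis using g_Phi[OF that(1,2)] by (simp add: sig_def)
    qed
  qed
  then show ?thesis by blast
qed

section \<open>Tensor products with partial permutation matrices\<close>

text \<open>
  \<open>cop n k act tau b\<close> is \<open>\<Sum>\<^sub>c b\<^sub>c \<otimes> x\<^sub>c\<close>, where \<open>x\<^sub>c\<close> is the partial permutation matrix of the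
  involution \<open>tau c\<close> of \<open>{s. act c s}\<close>.
\<close>

definition cop :: "nat \<Rightarrow> nat \<Rightarrow> (nat \<Rightarrow> nat \<Rightarrow> bool) \<Rightarrow> (nat \<Rightarrow> nat \<Rightarrow> nat) \<Rightarrow>
    (nat \<Rightarrow> nat \<Rightarrow> nat \<Rightarrow> complex) \<Rightarrow> (nat \<times> nat \<Rightarrow> complex) \<Rightarrow> nat \<times> nat \<Rightarrow> complex" where
  "cop n k act tau b f =
     (\<lambda>(p, s). \<Sum>c<n. if act c s then \<Sum>q<k. b c p q * f (q, tau c s) else 0)"

text \<open>Only the coefficients are replaced by their adjoints: the partial permutation matrices
  of involutions are self-adjoint.\<close>

definition adjb :: "(nat \<Rightarrow> nat \<Rightarrow> nat \<Rightarrow> complex) \<Rightarrow> nat \<Rightarrow> nat \<Rightarrow> nat \<Rightarrow> complex" where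
  "adjb b c p q = cnj (b c q p)"

lemma adjb_adjb [simp]: "adjb (adjb b) = b"
  by (simp add: adjb_def fun_eq_iff)

lemma sum_partial_involution:
  assumes "partial_involutions n m act tau" "c < n"
  shows "(\<Sum>s<m. if act c s then F s (tau c s) else (0::'a::comm_monoid_add)) =
         (\<Sum>s<m. if act c s then F (tau c s) s else 0)"
proof -
  let ?A = "{s \<in> {..<m}. act c s}"
  have "(\<Sum>s\<in>?A. F s (tau c s)) = (\<Sum>s\<in>?A. F (tau c s) s)"
    using assms unfolding partial_involutions_def
    by (intro sum.reindex_bij_witness[where i = "tau c" and j = "tau c"]) auto
  then show ?thesis by (simp only: sum.inter_filter[OF finite_lessThan])
qed

text \<open>Exchanging the two ends of every edge moves the operator to the other argument. The
  chain of \<open>sum.swap\<close> only brings the sum over \<open>s\<close> innermost and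
  back.\<close>

lemma cip_cop:
  assumes "partial_involutions n m act tau"
  shows "cip ({..<k} \<times> {..<m}) (cop n k act tau b f) g =
         cip ({..<k} \<times> {..<m}) f (cop n k act tau (adjb b) g)"
proof -
  have "cip ({..<k} \<times> {..<m}) (cop n k act tau b f) g =
    (\<Sum>p<k. \<Sum>s<m. \<Sum>c<n. \<Sum>q<k. if act c s then cnj (b c p q * f (q, tau c s)) * g (p, s) else 0)"
    unfolding cip_prod cop_def prod.case cnj_sum sum_distrib_right
    by (intro sum.cong refl) (simp add: cnj_sum sum_distrib_right)
  also have "\<dots> = (\<Sum>p<k. \<Sum>c<n. \<Sum>q<k. \<Sum>s<m.
      if act c s then cnj (b c p q * f (q, tau c s)) * g (p, s) else 0)"
    (is "_ = (\<Sum>p<k. \<Sum>c<n. \<Sum>q<k. \<Sum>s<m. ?A p c q s)")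
  proof (rule sum.cong[OF refl])
    fix p
    have "(\<Sum>s<m. \<Sum>c<n. \<Sum>q<k. ?A p c q s) = (\<Sum>c<n. \<Sum>s<m. \<Sum>q<k. ?A p c q s)"
      by (rule sum.swap)
    also have "\<dots> = (\<Sum>c<n. \<Sum>q<k. \<Sum>s<m. ?A p c q s)"
      by (rule sum.cong[OF refl], rule sum.swap)
    finally show "(\<Sum>s<m. \<Sum>c<n. \<Sum>q<k. ?A p c q s) = (\<Sum>c<n. \<Sum>q<k. \<Sum>s<m. ?A p c q s)" .
  qed
  also have "\<dots> = (\<Sum>p<k. \<Sum>c<n. \<Sum>q<k. \<Sum>s<m.
      if act c s then cnj (b c p q * f (q, s)) * g (p, tau c s) else 0)"
  proof (rule sum.cong[OF refl], rule sum.cong[OF refl], rule sum.cong[OF refl])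
    fix p c q assume "c \<in> {..<n}"
    then show "(\<Sum>s<m. if act c s then cnj (b c p q * f (q, tau c s)) * g (p, s) else 0) =
      (\<Sum>s<m. if act c s then cnj (b c p q * f (q, s)) * g (p, tau c s) else 0)"
      using sum_partial_involution[OF assms, of c "\<lambda>s t. cnj (b c p q * f (q, t)) * g (p, s)"]
      by simp
  qed
  also have "\<dots> = (\<Sum>q<k. \<Sum>s<m. \<Sum>c<n. \<Sum>p<k.
      if act c s then cnj (b c p q * f (q, s)) * g (p, tau c s) else 0)"
    (is "(\<Sum>p<k. \<Sum>c<n. \<Sum>q<k. \<Sum>s<m. ?B p c q s) = _")
  proof -
    have "(\<Sum>p<k. \<Sum>c<n. \<Sum>q<k. \<Sum>s<m. ?B p c q s) = (\<Sum>p<k. \<Sum>q<k. \<Sum>c<n. \<Sum>s<m. ?B p c q s)"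
      by (rule sum.cong[OF refl], rule sum.swap)
    also have "\<dots> = (\<Sum>q<k. \<Sum>p<k. \<Sum>c<n. \<Sum>s<m. ?B p c q s)" by (rule sum.swap)
    also have "\<dots> = (\<Sum>q<k. \<Sum>p<k. \<Sum>s<m. \<Sum>c<n. ?B p c q s)"
      by (rule sum.cong[OF refl], rule sum.cong[OF refl], rule sum.swap)
    also have "\<dots> = (\<Sum>q<k. \<Sum>s<m. \<Sum>p<k. \<Sum>c<n. ?B p c q s)"
      by (rule sum.cong[OF refl], rule sum.swap)
    also have "\<dots> = (\<Sum>q<k. \<Sum>s<m. \<Sum>c<n. \<Sum>p<k. ?B p c q s)"
      by (rule sum.cong[OF refl], rule sum.cong[OF refl], rule sum.swap)
    finally show ?thesis .
  qed
  also have "\<dots> = cip ({..<k} \<times> {..<m}) f (cop n k act tau (adjb b) g)"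
    unfolding cip_prod cop_def prod.case sum_distrib_left adjb_def
    by (intro sum.cong refl) (simp add: sum_distrib_left mult_ac)
  finally show ?thesis .
qed

text \<open>The squared norm of \<open>?g\<close> is the inner product of \<open>f\<close> with
  \<open>cop\<close> applied to \<open>?g\<close>; one factor, the norm of \<open>?g\<close>,
  cancels.\<close>

lemma cnm_cop_adjb_le:
  assumes inv: "partial_involutions n m act tau"
    and C: "\<And>f. cnm ({..<k} \<times> {..<m}) (cop n k act tau b f) \<le> C * cnm ({..<k} \<times> {..<m}) f"
  shows "cnm ({..<k} \<times> {..<m}) (cop n k act tau (adjb b) f) \<le> C * cnm ({..<k} \<times> {..<m}) f"
proof -
  let ?S = "{..<k} \<times> {..<m}"
  let ?g = "cop n k act tau (adjb b) f"
  have "(cnm ?S ?g)\<^sup>2 = cmod (cip ?S ?g ?g)" by (simp add: cip_self norm_power)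
  also have "\<dots> = cmod (cip ?S f (cop n k act tau b ?g))" by (simp add: cip_cop[OF inv])
  also have "\<dots> \<le> cnm ?S f * cnm ?S (cop n k act tau b ?g)" by (rule cmod_cip_le)
  also have "\<dots> \<le> cnm ?S f * (C * cnm ?S ?g)" by (intro mult_left_mono C) simp
  finally have *: "cnm ?S ?g * cnm ?S ?g \<le> (C * cnm ?S f) * cnm ?S ?g"
    by (simp add: power2_eq_square mult_ac)
  have "0 \<le> C * cnm ?S f" using C[of f] cnm_nonneg order_trans by blast
  with * show ?thesis
    using cnm_nonneg[of ?S ?g] by (smt (verit, best) mult_le_cancel_right)
qed

text \<open>For \<open>X = cop n k act tau b\<close> this is \<open>X\<^sup>*X\<close>, whose powers
  carry the moments of the singular values.\<close>

definition copsq :: "nat \<Rightarrow> nat \<Rightarrow> (nat \<Rightarrow> nat \<Rightarrow> bool) \<Rightarrow> (nat \<Rightarrow> nat \<Rightarrow> nat) \<Rightarrow>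
    (nat \<Rightarrow> nat \<Rightarrow> nat \<Rightarrow> complex) \<Rightarrow> (nat \<times> nat \<Rightarrow> complex) \<Rightarrow> nat \<times> nat \<Rightarrow> complex" where
  "copsq n k act tau b f = cop n k act tau (adjb b) (cop n k act tau b f)"

lemma cip_copsq:
  "partial_involutions n m act tau \<Longrightarrow> cip ({..<k} \<times> {..<m}) (copsq n k act tau b f) g =
     cip ({..<k} \<times> {..<m}) f (copsq n k act tau b g)"
  by (simp add: copsq_def cip_cop)

lemma cnm_copsq_funpow_le:
  assumes inv: "partial_involutions n m act tau"
    and C: "0 \<le> C" "\<And>f. cnm ({..<k} \<times> {..<m}) (cop n k act tau b f) \<le> C * cnm ({..<k} \<times> {..<m}) f"
  shows "cnm ({..<k} \<times> {..<m}) ((copsq n k act tau b ^^ i) f) \<le> (C\<^sup>2) ^ i * cnm ({..<k} \<times> {..<m}) f"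
proof (induction i)
  case (Suc i)
  let ?S = "{..<k} \<times> {..<m}" and ?g = "(copsq n k act tau b ^^ i) f"
  have "cnm ?S ((copsq n k act tau b ^^ Suc i) f) \<le> C * cnm ?S (cop n k act tau b ?g)"
    by (simp add: copsq_def cnm_cop_adjb_le[OF inv C(2)])
  also have "\<dots> \<le> C * (C * cnm ?S ?g)" using C by (intro mult_left_mono) auto
  also have "\<dots> \<le> C * (C * ((C\<^sup>2) ^ i * cnm ?S f))" using C Suc by (intro mult_left_mono) auto
  finally show ?case by (simp add: power2_eq_square mult_ac)
qed simp

lemma cop_cong:
  assumes "partial_involutions n m act tau" "\<And>z. z \<in> {..<k} \<times> {..<m} \<Longrightarrow> f z = g z"
  shows "cnm ({..<k} \<times> {..<m}) (cop n k act tau b f) = cnm ({..<k} \<times> {..<m}) (cop n k act tau b g)"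
  using assms unfolding partial_involutions_def
  by (intro cnm_cong) (auto simp: cop_def intro!: sum.cong)

lemma cop_scale: "cop n k act tau b (\<lambda>z. c * f z) = (\<lambda>z. c * cop n k act tau b f z)"
  by (auto simp: cop_def fun_eq_iff sum_distrib_left mult_ac intro!: sum.cong)

context tree_covering
begin

text \<open>Inside the ball every colour is active, so ball and covering graph offer the same
  \<open>n\<close> edges and \<open>Phi v\<close> matches their ends. One application reads
  \<open>F\<close> one level further out.\<close>

lemma cop_pullback:
  assumes "v < N" "Suc l \<le> R" "s < m" "lev s \<le> l"
    and "\<And>q t. t < m \<Longrightarrow> lev t \<le> Suc l \<Longrightarrow> F (q, Phi v t) = g (q, t)"
  shows "cop n k (\<lambda>_ _. True) sig b F (p, Phi v s) = cop n k act tau b g (p, s)"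
proof -
  have "lev (tau c s) \<le> Suc l" "tau c s < m" "act c s" "Phi v (tau c s) = sig c (Phi v s)"
    if "c < n" for c
    using act[of s c] lev[of s c] Phi(4)[of v s c] tau assms that
    by (auto simp: partial_involutions_def intro: order_trans)
  then show ?thesis
    using assms(5) unfolding cop_def by (auto intro!: sum.cong) (metis)
qed

lemma copsq_pullback:
  assumes "v < N" "Suc (Suc l) \<le> R" "s < m" "lev s \<le> l"
    and "\<And>q t. t < m \<Longrightarrow> lev t \<le> Suc (Suc l) \<Longrightarrow> F (q, Phi v t) = g (q, t)"
  shows "copsq n k (\<lambda>_ _. True) sig b F (p, Phi v s) = copsq n k act tau b g (p, s)"
  unfolding copsq_def using assms
  by (intro cop_pullback[where l = l] cop_pullback[where l = "Suc l"]) auto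

text \<open>Each factor \<open>X\<^sup>*X\<close> uses up two levels, hence the budget
  \<open>lev s + 2 * i \<le> R\<close>. In the base case the point mass at \<open>v\<close> pulls
  back to that at the root, because only the root lies over \<open>v\<close>.\<close>

lemma copsq_funpow_pullback:
  assumes "v < N"
  shows "s < m \<Longrightarrow> lev s + 2 * i \<le> R \<Longrightarrow>
    (copsq n k (\<lambda>_ _. True) sig b ^^ i) (cdelta (j, v)) (p, Phi v s) =
    (copsq n k act tau b ^^ i) (cdelta (j, root)) (p, s)"
proof (induction i arbitrary: s p)
  case 0
  then have "Phi v s = v \<longleftrightarrow> s = root" using Phi(2)[OF assms] Phi(3)[OF assms, of s] by blast
  then show ?case by (simp add: cdelta_def)
next
  case (Suc i)
  then show ?case unfolding funpow.simps comp_apply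
    by (intro copsq_pullback[where l = "lev s"] Suc.IH assms) auto
qed

text \<open>
  The diagonal entries of a power of \<open>X\<^sup>*X\<close> only see a ball of the covering graph, where it is a
  tree; so \<open>C\<close> bounds all these moments, and few singular values of \<open>X\<close> exceed \<open>c > C\<close>.
\<close>

lemma cop_projection:
  assumes C: "0 \<le> C" "\<And>f. cnm ({..<k} \<times> {..<m}) (cop n k act tau b f) \<le> C * cnm ({..<k} \<times> {..<m}) f"
    and c: "0 < c" and R: "4 * 2 ^ i \<le> R"
    and \<delta>: "real k * real k * (C / c) ^ (4 * 2 ^ i) \<le> \<delta>"
  shows "\<exists>e. hproj N e \<and> real N * (1 - \<delta>) \<le> mtrace N e \<and>
    (\<forall>f. cnm ({..<k} \<times> {..<N}) (cop n k (\<lambda>_ _. True) sig b (amp N e f)) \<le> c * cnm ({..<k} \<times> {..<N}) f)"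
proof -
  let ?S = "{..<k} \<times> {..<N}" and ?T = "{..<k} \<times> {..<m}"
  let ?X = "cop n k (\<lambda>_ _. True) sig b" and ?M = "copsq n k (\<lambda>_ _. True) sig b"
  have B: "cmod ((?M ^^ (2 * 2 ^ i)) (cdelta z) z) \<le> (C\<^sup>2) ^ (2 * 2 ^ i)" if z: "z \<in> ?S" for z
  proof -
    obtain j v where z': "z = (j, v)" "j < k" "v < N" using z by auto
    have 1: "cnm ?T (cdelta (j, root)) = 1" using root(1) z'(2) by (intro cnm_cdelta) auto
    define g where "g = (copsq n k act tau b ^^ (2 * 2 ^ i)) (cdelta (j, root))"
    \<comment> \<open>The power involves walks of length \<open>4 * 2 ^ i \<le> R\<close> from
      \<open>v\<close>, which stay within the ball.\<close>
    have eq: "(?M ^^ (2 * 2 ^ i)) (cdelta z) z = g (j, root)"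
      using copsq_funpow_pullback[OF z'(3) root(1), of "2 * 2 ^ i" k b j j] R root z' Phi(2)
      by (simp add: g_def)
    have "cmod (g (j, root)) \<le> cnm ?T g"
      using root z' by (intro cmod_le_cnm) auto
    also have "cnm ?T g \<le> (C\<^sup>2) ^ (2 * 2 ^ i)"
      unfolding g_def
      using cnm_copsq_funpow_le[OF tau C, of "2 * 2 ^ i" "cdelta (j, root)"] by (simp only: 1 mult_1_right)
    finally show ?thesis by (simp only: eq)
  qed
  \<comment> \<open>Vectors on which \<open>X\<close> is large have a large quadratic form of
    \<open>X\<^sup>*X\<close>. The trace count is applied to squares with exponent
    \<open>2 * 2 ^ i\<close>, that is \<open>4 * 2 ^ i\<close> for \<open>c\<close> and
    \<open>C\<close>.\<close>
  have count: "real r \<le> real (k * N) * (C / c) ^ (4 * 2 ^ i)"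
    if ort: "corthonormal ?S r \<xi>" and large: "\<And>j. j < r \<Longrightarrow> c < cnm ?S (?X (\<xi> j))" for r \<xi>
  proof -
    have sa: "cip ?S (?M f) g = cip ?S f (?M g)" for f g
      by (rule cip_copsq[OF sig])
    have c2: "c\<^sup>2 \<le> cmod (cip ?S (\<xi> j) (?M (\<xi> j)))" if "j < r" for j
    proof -
      have "c\<^sup>2 \<le> (cnm ?S (?X (\<xi> j)))\<^sup>2" using large[OF that] c by (intro power_mono) auto
      also have "\<dots> = cmod (cip ?S (?X (\<xi> j)) (?X (\<xi> j)))" by (simp add: cip_self norm_power)
      also have "\<dots> = cmod (cip ?S (\<xi> j) (?M (\<xi> j)))" unfolding cip_cop[OF sig] copsq_def ..
      finally show ?thesis .
    qed
    have fin: "finite ?S" by simp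
    have c0: "0 \<le> c\<^sup>2" by simp
    have "real r * (c\<^sup>2) ^ (2 * 2 ^ i) \<le> real (card ?S) * (C\<^sup>2) ^ (2 * 2 ^ i)"
      using sa fin ort c0 c2 B
      by (rule orthonormal_count_trace[of ?S ?M r \<xi> "c\<^sup>2" i "(C\<^sup>2) ^ (2 * 2 ^ i)"])
    then have "real r * c ^ (4 * 2 ^ i) \<le> real (k * N) * C ^ (4 * 2 ^ i)"
      by (simp add: power_mult[symmetric])
    then show ?thesis using c by (simp add: power_divide pos_le_divide_eq)
  qed
  obtain e where e: "hproj N e" "real N - real k * (real (k * N) * (C / c) ^ (4 * 2 ^ i)) \<le> mtrace N e"
    "\<And>f. cnm ?S (?X (amp N e f)) \<le> c * cnm ?S f"
  proof -
    have "\<exists>e. hproj N e \<and> real N - real k * (real (k * N) * (C / c) ^ (4 * 2 ^ i)) \<le> mtrace N e \<and>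
        (\<forall>f. cnm ?S (?X (amp N e f)) \<le> c * cnm ?S f)"
    proof (rule projection_cutting_large_directions[where L = "\<lambda>f. cnm ?S (?X f)"])
      show "cnm ?S (?X f) = cnm ?S (?X g)" if "\<And>z. z \<in> ?S \<Longrightarrow> f z = g z" for f g
        by (rule cop_cong[OF sig that])
      show "cnm ?S (?X (\<lambda>z. a * f z)) = cmod a * cnm ?S (?X f)" for a f
        by (simp only: cop_scale cnm_scale)
    qed (use c count in auto)
    then show ?thesis using that by blast
  qed
  \<comment> \<open>One factor \<open>k\<close> comes from the dimension \<open>k * N\<close> in the
    trace count, the other from the price of each removed direction.\<close>
  have "real N * (real k * real k * (C / c) ^ (4 * 2 ^ i)) \<le> real N * \<delta>"
    using \<delta> by (intro mult_left_mono) auto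
  then have "real N * (1 - \<delta>) \<le> mtrace N e" using e(2) by (simp add: algebra_simps)
  then show ?thesis using e by blast
qed

end

section \<open>Norms on the dual of \<open>\<ell>\<^sub>\<infinity>\<^sup>n\<close>\<close>

lemma L2_set_prod:
  "L2_set (\<lambda>i. L2_set (\<lambda>p. f i p) B) A = L2_set (\<lambda>z. f (fst z) (snd z)) (A \<times> B)"
  by (simp add: L2_set_def sum_nonneg sum.cartesian_product case_prod_beta)

lemma L2_set_norm_sum_le:
  fixes f :: "'c \<Rightarrow> 'i \<Rightarrow> 'a::real_normed_vector"
  assumes "finite J"
  shows "L2_set (\<lambda>i. norm (\<Sum>c\<in>J. f c i)) A \<le> (\<Sum>c\<in>J. L2_set (\<lambda>i. norm (f c i)) A)"
  using assms
proof induction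
  case (insert c J)
  have "L2_set (\<lambda>i. norm (\<Sum>c\<in>insert c J. f c i)) A \<le>
      L2_set (\<lambda>i. norm (f c i) + norm (\<Sum>c\<in>J. f c i)) A"
    using insert by (intro L2_set_mono) (auto intro: norm_triangle_ineq)
  also have "\<dots> \<le> L2_set (\<lambda>i. norm (f c i)) A + L2_set (\<lambda>i. norm (\<Sum>c\<in>J. f c i)) A"
    by (rule L2_set_triangle_ineq)
  finally show ?case using insert by simp
qed (simp add: L2_set_def)

text \<open>The outer block index comes first in the pairs here, whereas in \<open>cop\<close> it
  comes second.\<close>

definition mapp :: "nat \<Rightarrow> nat \<Rightarrow> (nat \<Rightarrow> nat \<Rightarrow> nat \<Rightarrow> nat \<Rightarrow> complex) \<Rightarrow>
    (nat \<times> nat \<Rightarrow> complex) \<Rightarrow> nat \<times> nat \<Rightarrow> complex" where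
  "mapp k l A f = (\<lambda>(i, p). \<Sum>j<l. \<Sum>q<k. A i j p q * f (j, q))"

lemma matrix_norm_ge:
  assumes "cnm ({..<l} \<times> {..<k}) f \<le> 1"
  shows "ereal (cnm ({..<l} \<times> {..<k}) (mapp k l A f)) \<le> os_norm (matrix_opspace k E) l A"
  unfolding matrix_opspace_def using assms
  by (auto simp: L2_set_prod cnm_def mapp_def case_prod_beta intro!: SUP_upper2[of "curry f"])

text \<open>The supremum over the unit ball in homogeneous form; vectors of norm zero are treated
  apart, as they cannot be normalised.\<close>

lemma matrix_norm_le_iff:
  assumes "0 \<le> r"
  shows "os_norm (matrix_opspace k E) l A \<le> ereal r \<longleftrightarrow>
    (\<forall>f. cnm ({..<l} \<times> {..<k}) (mapp k l A f) \<le> r * cnm ({..<l} \<times> {..<k}) f)"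
    (is "?L \<longleftrightarrow> ?R")
proof
  let ?S = "{..<l} \<times> {..<k}"
  assume L: ?L
  show ?R
  proof
    fix f
    show "cnm ?S (mapp k l A f) \<le> r * cnm ?S f"
    proof (cases "cnm ?S f = 0")
      case True
      then have "f z = 0" if "z \<in> ?S" for z using cnm_eq_0D[of ?S f z] that by simp
      then have "mapp k l A f z = 0" for z by (auto simp: mapp_def case_prod_beta intro!: sum.neutral)
      then have "cnm ?S (mapp k l A f) = 0" by (simp add: cnm_def L2_set_def)
      then show ?thesis using assms by simp
    next
      case False
      then have pos: "cnm ?S f > 0" using cnm_nonneg[of ?S f] by linarith
      define t where "t = complex_of_real (1 / cnm ?S f)"
      have t: "cmod t = 1 / cnm ?S f" using pos by (simp add: t_def norm_divide)
      have "cnm ?S (\<lambda>z. t * f z) \<le> 1" unfolding cnm_scale t using pos by simp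
      from order_trans[OF matrix_norm_ge[OF this] L]
      have "cnm ?S (mapp k l A (\<lambda>z. t * f z)) \<le> r" by simp
      moreover have "mapp k l A (\<lambda>z. t * f z) = (\<lambda>z. t * mapp k l A f z)"
        by (auto simp: mapp_def fun_eq_iff sum_distrib_left mult_ac)
      ultimately have "cmod t * cnm ?S (mapp k l A f) \<le> r" by (simp only: cnm_scale)
      then show ?thesis using pos by (simp add: t pos_divide_le_eq)
    qed
  qed
next
  let ?S = "{..<l} \<times> {..<k}"
  assume R: ?R
  show ?L
    unfolding matrix_opspace_def opspace.simps
  proof (rule SUP_least)
    fix x :: "nat \<Rightarrow> nat \<Rightarrow> complex"
    assume "x \<in> {x. L2_set (\<lambda>j. L2_set (\<lambda>q. cmod (x j q)) {..<k}) {..<l} \<le> 1}"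
    then have x: "cnm ?S (case_prod x) \<le> 1"
      by (simp add: L2_set_prod cnm_def case_prod_beta)
    have "L2_set (\<lambda>i. L2_set (\<lambda>p. cmod (\<Sum>j<l. \<Sum>q<k. A i j p q * x j q)) {..<k}) {..<l} =
      cnm ?S (mapp k l A (case_prod x))"
      by (simp add: L2_set_prod cnm_def case_prod_beta mapp_def)
    also have "\<dots> \<le> r * cnm ?S (case_prod x)" using R by blast
    also have "\<dots> \<le> r * 1" using x assms by (intro mult_left_mono) auto
    finally show "ereal (L2_set (\<lambda>i. L2_set (\<lambda>p. cmod (\<Sum>j<l. \<Sum>q<k. A i j p q * x j q)) {..<k}) {..<l})
      \<le> ereal r" by simp
  qed
qed

text \<open>The element of the dual with coordinates \<open>t\<close> in the canonical basis; the
  value 0 off the carrier follows the convention of \<open>dual_opspace\<close>.\<close>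

definition efun :: "nat \<Rightarrow> (nat \<Rightarrow> complex) \<Rightarrow> (nat \<Rightarrow> nat \<Rightarrow> complex) \<Rightarrow> complex" where
  "efun n t x = (if x \<in> os_carrier (ell_infty n) then \<Sum>c<n. t c * x c c else 0)"

lemma carrier_ell_infty: "os_carrier (ell_infty n) = {a. \<forall>i j. a i j \<noteq> 0 \<longrightarrow> i = j \<and> i < n}"
  by (simp add: ell_infty_def matrix_opspace_def)

text \<open>Test on vectors supported in the coordinate \<open>c\<close>: off-diagonal entries
  vanish, so just the scalar matrix of the \<open>c\<close>-th diagonal entries acts.\<close>

lemma ell_infty_diag_contraction:
  assumes car: "\<And>i j. i < l \<Longrightarrow> j < l \<Longrightarrow> X i j \<in> os_carrier (ell_infty n)"
    and X: "os_norm (ell_infty n) l X \<le> 1" and c: "c < n"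
  shows "L2_set (\<lambda>i. cmod (\<Sum>j<l. X i j c c * y j)) {..<l} \<le> L2_set (\<lambda>j. cmod (y j)) {..<l}"
proof -
  define f where "f = (\<lambda>(j, q). if q = c then y j else (0::complex))"
  let ?S = "{..<l} \<times> {..<n}"
  have le: "cnm ?S (mapp n l X f) \<le> 1 * cnm ?S f"
    using X matrix_norm_le_iff[of 1 n _ l X] unfolding ell_infty_def by (simp add: one_ereal_def)
  have sq: "cnm ?S (\<lambda>(j, q). if q = c then g j else 0) = L2_set (\<lambda>j. cmod (g j)) {..<l}" for g
    unfolding cnm_def L2_set_def sum.cartesian_product'
    using c by (simp add: if_distrib[of cmod] if_distrib[of "\<lambda>x. x\<^sup>2"] cong: if_cong)
  have "cnm ?S (mapp n l X f) = cnm ?S (\<lambda>(j, q). if q = c then \<Sum>i<l. X j i c c * y i else 0)"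
  proof (rule cnm_cong)
    fix z assume "z \<in> ?S"
    then obtain i p where z: "z = (i, p)" "i < l" "p < n" by auto
    have "(\<Sum>q<n. X i j p q * f (j, q)) = X i j p c * y j" for j
      using c by (simp add: f_def if_distrib[of "\<lambda>x. _ * x"] cong: if_cong)
    moreover have "X i j p c = 0" if "p \<noteq> c" "j < l" for j
      using car[OF z(2) that(2)] that(1) by (auto simp: carrier_ell_infty)
    ultimately show "mapp n l X f z = (\<lambda>(j, q). if q = c then \<Sum>i<l. X j i c c * y i else 0) z"
      using z by (auto simp: mapp_def)
  qed
  with le show ?thesis unfolding f_def by (simp only: sq)
qed

lemma ell_infty_entry_le:
  assumes "x \<in> os_carrier (ell_infty n)" "c < n"
  shows "ereal (cmod (x c c)) \<le> os_norm (ell_infty n) 1 (\<lambda>_ _. x)"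
proof -
  let ?S = "{..<1::nat} \<times> {..<n}"
  have 1: "(0, c) \<in> ?S" "finite ?S" using assms by auto
  have "cmod (x c c) = cmod (mapp n 1 (\<lambda>_ _. x) (cdelta (0, c)) (0, c))"
    using assms by (simp add: mapp_def cdelta_def if_distrib[of "\<lambda>x. _ * x"] cong: if_cong)
  also have "\<dots> \<le> cnm ?S (mapp n 1 (\<lambda>_ _. x) (cdelta (0, c)))"
    by (rule cmod_le_cnm[OF 1(2,1)])
  finally have "ereal (cmod (x c c)) \<le> ereal (cnm ?S (mapp n 1 (\<lambda>_ _. x) (cdelta (0, c))))" by simp
  also have "\<dots> \<le> os_norm (ell_infty n) 1 (\<lambda>_ _. x)"
    unfolding ell_infty_def using cnm_cdelta[OF 1(2,1)] by (intro matrix_norm_ge) simp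
  finally show ?thesis .
qed

lemma scaleC_entry: "(c *\<^sub>C x) i j = c * x i j" for x :: "'i \<Rightarrow> 'j \<Rightarrow> complex"
  by (simp add: scaleC_fun_def scaleC_complex_def)

lemma efun_in_carrier: "efun n t \<in> os_carrier (E1 n)"
proof -
  have add: "x + y \<in> os_carrier (ell_infty n)"
    if "x \<in> os_carrier (ell_infty n)" "y \<in> os_carrier (ell_infty n)" for x y
    using that by (auto simp: carrier_ell_infty) (metis add_0)+
  have scale: "c *\<^sub>C x \<in> os_carrier (ell_infty n)" if "x \<in> os_carrier (ell_infty n)" for c x
    using that by (auto simp: carrier_ell_infty scaleC_entry)
  have "clinear_on (os_carrier (ell_infty n)) (efun n t)"
    unfolding clinear_on_def
    by (simp add: efun_def add scale scaleC_entry scaleC_complex_def sum_distrib_left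
        algebra_simps sum.distrib)
  \<comment> \<open>The \<open>+ 1\<close> makes the constant positive, so that an infinite norm
    yields an infinite bound even for \<open>t = 0\<close>.\<close>
  moreover have "ereal (cmod (efun n t x)) \<le> ereal ((\<Sum>c<n. cmod (t c)) + 1) * os_norm (ell_infty n) 1 (\<lambda>_ _. x)"
    if x: "x \<in> os_carrier (ell_infty n)" for x
  proof -
    have T0: "0 < (\<Sum>c<n. cmod (t c)) + 1" by (smt (verit) sum_nonneg norm_ge_zero)
    have nn: "0 \<le> os_norm (ell_infty n) 1 (\<lambda>_ _. x)"
    proof -
      have "cnm ({..<1} \<times> {..<n}) (\<lambda>_. 0) \<le> 1" by (simp add: cnm_def L2_set_def)
      from matrix_norm_ge[OF this] show ?thesis
        unfolding ell_infty_def by (rule order_trans[rotated]) simp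
    qed
    show ?thesis
    proof (cases "os_norm (ell_infty n) 1 (\<lambda>_ _. x)")
      case (real r)
      then have "cmod (x c c) \<le> r" if "c < n" for c using ell_infty_entry_le[OF x that] by simp
      moreover have "0 \<le> r" using nn real by simp
      ultimately have "cmod (\<Sum>c<n. t c * x c c) \<le> (\<Sum>c<n. cmod (t c) * r)"
        by (intro order_trans[OF norm_sum] sum_mono) (auto simp: norm_mult intro!: mult_left_mono)
      also have "\<dots> \<le> ((\<Sum>c<n. cmod (t c)) + 1) * r"
        unfolding sum_distrib_right[symmetric] using \<open>0 \<le> r\<close> by (intro mult_right_mono) auto
      finally show ?thesis using real x by (simp add: efun_def)
    qed (use T0 nn in auto)
  qed
  ultimately show ?thesis
    unfolding E1_def dual_opspace_def by (auto simp: efun_def)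
qed

lemma os_norm_E1:
  "os_norm (E1 n) m Z =
    (SUP l\<in>{1..}. SUP X\<in>{X. (\<forall>i<l. \<forall>j<l. X i j \<in> os_carrier (ell_infty n)) \<and> os_norm (ell_infty n) l X \<le> 1}.
      os_norm (Mat m) l (\<lambda>i j s t. if s < m \<and> t < m then Z s t (X i j) else 0))"
  by (simp add: E1_def dual_opspace_def cb_norm_def)

section \<open>Upper bound on the tree and lower bound on the finite graph\<close>

context tree_covering
begin

text \<open>Cauchy-Schwarz splits each term into \<open>sqrt h\<close> and
  \<open>G / sqrt h\<close>. The supersolution property bounds the first factor; exchanging the ends
  of the edges brings back the sum of the weights around \<open>s\<close>, to which the same
  property applies again.\<close>

lemma schur_test:
  assumes "n \<ge> 1"
  shows "(\<Sum>s<m. (\<Sum>c | c < n \<and> act c s. G (tau c s))\<^sup>2) \<le> (2 * sqrt (real n - 1))\<^sup>2 * (\<Sum>s<m. (G s)\<^sup>2)"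
proof -
  let ?D = "2 * sqrt (real n - 1)"
  have hp: "0 < h (tau c s)" if "s < m" "c < n" "act c s" for c s
    using tau h_pos that by (auto simp: partial_involutions_def)
  have D0: "0 \<le> ?D" using assms by simp
  have st: "(\<Sum>c | c < n \<and> act c s. G (tau c s))\<^sup>2 \<le>
      (\<Sum>c<n. if act c s then ?D * (h s * ((G (tau c s))\<^sup>2 / h (tau c s))) else 0)" if "s < m" for s
  proof -
    let ?J = "{c. c < n \<and> act c s}"
    have eq: "(\<Sum>c\<in>?J. G (tau c s)) = (\<Sum>c\<in>?J. sqrt (h (tau c s)) * (G (tau c s) / sqrt (h (tau c s))))"
      using hp[OF that] by (intro sum.cong refl) (auto, fastforce)
    have "(\<Sum>c\<in>?J. G (tau c s))\<^sup>2 \<le>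
        (\<Sum>c\<in>?J. (sqrt (h (tau c s)))\<^sup>2) * (\<Sum>c\<in>?J. (G (tau c s) / sqrt (h (tau c s)))\<^sup>2)"
      unfolding eq by (rule Cauchy_Schwarz_ineq_sum)
    also have "\<dots> = (\<Sum>c\<in>?J. h (tau c s)) * (\<Sum>c\<in>?J. (G (tau c s))\<^sup>2 / h (tau c s))"
    proof -
      have "(sqrt (h (tau c s)))\<^sup>2 = h (tau c s)" if "c \<in> ?J" for c
        using hp[OF \<open>s < m\<close>, of c] that by simp
      then show ?thesis by (simp add: power_divide)
    qed
    also have "\<dots> \<le> (?D * h s) * (\<Sum>c\<in>?J. (G (tau c s))\<^sup>2 / h (tau c s))"
      using hp[OF that] by (intro mult_right_mono h_sum that sum_nonneg) (auto intro!: divide_nonneg_pos)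
    also have "\<dots> = (\<Sum>c\<in>{c \<in> {..<n}. act c s}. ?D * (h s * ((G (tau c s))\<^sup>2 / h (tau c s))))"
      by (simp add: sum_distrib_left mult.assoc)
    finally show ?thesis by (simp only: sum.inter_filter[OF finite_lessThan])
  qed
  have "(\<Sum>s<m. (\<Sum>c | c < n \<and> act c s. G (tau c s))\<^sup>2) \<le>
      (\<Sum>s<m. \<Sum>c<n. if act c s then ?D * (h s * ((G (tau c s))\<^sup>2 / h (tau c s))) else 0)"
    by (intro sum_mono st) auto
  also have "\<dots> = (\<Sum>c<n. \<Sum>s<m. if act c s then ?D * (h s * ((G (tau c s))\<^sup>2 / h (tau c s))) else 0)"
    by (rule sum.swap)
  also have "\<dots> = (\<Sum>c<n. \<Sum>s<m. if act c s then ?D * (h (tau c s) * ((G s)\<^sup>2 / h s)) else 0)"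
    using sum_partial_involution[OF tau, of _ "\<lambda>s t. ?D * (h s * ((G t)\<^sup>2 / h t))"]
    by (rule sum.cong[OF refl]) simp
  also have "\<dots> = (\<Sum>s<m. \<Sum>c<n. if act c s then ?D * (h (tau c s) * ((G s)\<^sup>2 / h s)) else 0)"
    by (rule sum.swap)
  also have "\<dots> = (\<Sum>s<m. ?D * ((\<Sum>c | c < n \<and> act c s. h (tau c s)) * ((G s)\<^sup>2 / h s)))"
  proof (intro sum.cong refl)
    fix s
    have "(\<Sum>c<n. if act c s then ?D * (h (tau c s) * ((G s)\<^sup>2 / h s)) else 0) =
      (\<Sum>c\<in>{c \<in> {..<n}. act c s}. ?D * (h (tau c s) * ((G s)\<^sup>2 / h s)))"
      by (simp only: sum.inter_filter[OF finite_lessThan])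
    then show "(\<Sum>c<n. if act c s then ?D * (h (tau c s) * ((G s)\<^sup>2 / h s)) else 0) =
      ?D * ((\<Sum>c | c < n \<and> act c s. h (tau c s)) * ((G s)\<^sup>2 / h s))"
      by (simp add: sum_distrib_left sum_distrib_right sum_divide_distrib)
  qed
  also have "\<dots> \<le> (\<Sum>s<m. ?D * ((?D * h s) * ((G s)\<^sup>2 / h s)))"
    using h_pos
    by (intro sum_mono mult_left_mono mult_right_mono h_sum D0) (auto intro!: divide_nonneg_pos)
  also have "\<dots> = (\<Sum>s<m. ?D\<^sup>2 * (G s)\<^sup>2)"
  proof (intro sum.cong refl)
    fix s assume "s \<in> {..<m}"
    then have "h s \<noteq> 0" using h_pos[of s] by simp
    then show "?D * ((?D * h s) * ((G s)\<^sup>2 / h s)) = ?D\<^sup>2 * (G s)\<^sup>2" by (simp add: power2_eq_square)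
  qed
  finally show ?thesis by (simp add: sum_distrib_left)
qed

text \<open>The diagonal slices of a contractive test matrix \<open>X\<close> are contractions, so
  the norm of the result at the vertex \<open>s\<close> is at most the sum of the norms
  \<open>G\<close> at its neighbours. This leaves the scalar adjacency operator of the ball.\<close>

lemma E1_norm_tree_le:
  assumes "n \<ge> 1"
  shows "os_norm (E1 n) m (\<lambda>s t. efun n (\<lambda>c. if act c s \<and> tau c s = t then 1 else 0))
    \<le> ereal (2 * sqrt (real n - 1))"
  unfolding os_norm_E1
proof (intro SUP_least)
  fix l :: nat and X :: "nat \<Rightarrow> nat \<Rightarrow> nat \<Rightarrow> nat \<Rightarrow> complex"
  assume "X \<in> {X. (\<forall>i<l. \<forall>j<l. X i j \<in> os_carrier (ell_infty n)) \<and> os_norm (ell_infty n) l X \<le> 1}"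
  then have car: "\<And>i j. i < l \<Longrightarrow> j < l \<Longrightarrow> X i j \<in> os_carrier (ell_infty n)"
    and X: "os_norm (ell_infty n) l X \<le> 1" by auto
  let ?D = "2 * sqrt (real n - 1)" and ?S = "{..<l} \<times> {..<m}"
  have D0: "0 \<le> ?D" using assms by simp
  define Z where "Z s t = efun n (\<lambda>c. if act c s \<and> tau c s = t then 1 else 0)" for s t
  define A where "A = (\<lambda>i j s t. if s < m \<and> t < m then Z s t (X i j) else 0)"
  have "cnm ?S (mapp m l A f) \<le> ?D * cnm ?S f" for f
  proof -
    define G where "G s = L2_set (\<lambda>j. cmod (f (j, s))) {..<l}" for s
    have val: "mapp m l A f (i, s) = (\<Sum>c | c < n \<and> act c s. \<Sum>j<l. X i j c c * f (j, tau c s))"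
      if "i < l" "s < m" for i s
    proof -
      have "mapp m l A f (i, s) =
        (\<Sum>j<l. \<Sum>t<m. \<Sum>c<n. if act c s then (if tau c s = t then X i j c c * f (j, t) else 0) else 0)"
        unfolding mapp_def prod.case using that car
        by (intro sum.cong refl) (auto simp: A_def Z_def efun_def sum_distrib_right intro!: sum.cong)
      also have "\<dots> = (\<Sum>j<l. \<Sum>c<n. \<Sum>t<m. if act c s then (if tau c s = t then X i j c c * f (j, t) else 0) else 0)"
        by (rule sum.cong[OF refl], rule sum.swap)
      also have "\<dots> = (\<Sum>j<l. \<Sum>c<n. if act c s then X i j c c * f (j, tau c s) else 0)"
        using tau that by (intro sum.cong refl) (auto simp: partial_involutions_def)
      also have "\<dots> = (\<Sum>c<n. \<Sum>j<l. if act c s then X i j c c * f (j, tau c s) else 0)"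
        by (rule sum.swap)
      also have "\<dots> = (\<Sum>c<n. if act c s then \<Sum>j<l. X i j c c * f (j, tau c s) else 0)"
        by (intro sum.cong refl) auto
      also have "\<dots> = (\<Sum>c\<in>{c\<in>{..<n}. act c s}. \<Sum>j<l. X i j c c * f (j, tau c s))"
        by (simp only: sum.inter_filter[OF finite_lessThan])
      finally show ?thesis by simp
    qed
    have col: "L2_set (\<lambda>i. cmod (mapp m l A f (i, s))) {..<l} \<le> (\<Sum>c | c < n \<and> act c s. G (tau c s))"
      if "s < m" for s
    proof -
      have "L2_set (\<lambda>i. cmod (mapp m l A f (i, s))) {..<l} =
        L2_set (\<lambda>i. cmod (\<Sum>c | c < n \<and> act c s. \<Sum>j<l. X i j c c * f (j, tau c s))) {..<l}"
        using val that by (intro L2_set_cong) auto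
      also have "\<dots> \<le> (\<Sum>c | c < n \<and> act c s. L2_set (\<lambda>i. cmod (\<Sum>j<l. X i j c c * f (j, tau c s))) {..<l})"
        by (rule L2_set_norm_sum_le) simp
      also have "\<dots> \<le> (\<Sum>c | c < n \<and> act c s. G (tau c s))"
        unfolding G_def by (intro sum_mono ell_infty_diag_contraction[OF car X]) auto
      finally show ?thesis .
    qed
    have sq: "(cnm ?S g)\<^sup>2 = (\<Sum>s<m. (L2_set (\<lambda>i. cmod (g (i, s))) {..<l})\<^sup>2)" for g
      unfolding cnm_power2 sum.cartesian_product' by (subst sum.swap) (simp add: L2_set_def sum_nonneg)
    have "(cnm ?S (mapp m l A f))\<^sup>2 \<le> (\<Sum>s<m. (\<Sum>c | c < n \<and> act c s. G (tau c s))\<^sup>2)"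
      unfolding sq using col by (intro sum_mono power_mono) auto
    also have "\<dots> \<le> ?D\<^sup>2 * (\<Sum>s<m. (G s)\<^sup>2)" by (rule schur_test[OF assms])
    also have "\<dots> = (?D * cnm ?S f)\<^sup>2" unfolding power_mult_distrib sq G_def ..
    finally show ?thesis using D0 by (meson power2_le_imp_le mult_nonneg_nonneg cnm_nonneg)
  qed
  then have "os_norm (Mat m) l A \<le> ereal ?D"
    unfolding Mat_def using matrix_norm_le_iff[OF D0] by blast
  then show "os_norm (Mat m) l (\<lambda>i j s t. if s < m \<and> t < m
      then efun n (\<lambda>c. if act c s \<and> tau c s = t then 1 else 0) (X i j) else 0) \<le> ereal ?D"
    unfolding A_def Z_def .
qed

end

text \<open>The matrix is \<open>\<Sum> e\<^sub>c \<otimes> x\<^sub>c e\<close>. The test matrix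
  \<open>X\<close> has the permutation matrix of \<open>sig c\<close> as its \<open>c\<close>-th
  diagonal slice, and \<open>f\<close> is the maximally entangled unit vector, at which each colour
  contributes \<open>tr e / N\<close>.\<close>

lemma E1_norm_trace_ge:
  assumes sig: "partial_involutions n N (\<lambda>_ _. True) sig" and N: "0 < N"
  shows "ereal (real n * mtrace N e / real N) \<le> os_norm (E1 n) N (\<lambda>v w. efun n (\<lambda>c. e (sig c v) w))"
proof -
  define X where "X = (\<lambda>i j p q. if p = q \<and> p < n \<and> j = sig p i then 1 else (0::complex))"
  have s1: "sig c v < N" "sig c (sig c v) = v" if "c < n" "v < N" for c v
    using sig that by (auto simp: partial_involutions_def)
  have sbij: "(\<Sum>i<N. F (sig c i)) = (\<Sum>i<N. F i)" if "c < n" for c and F :: "nat \<Rightarrow> 'z::comm_monoid_add"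
    using s1 that by (intro sum.reindex_bij_witness[where i = "sig c" and j = "sig c"]) auto
  have car: "X i j \<in> os_carrier (ell_infty n)" for i j
    by (auto simp: X_def carrier_ell_infty)
  have Xle: "os_norm (ell_infty n) N X \<le> 1"
  proof -
    have "cnm ({..<N} \<times> {..<n}) (mapp n N X f) \<le> 1 * cnm ({..<N} \<times> {..<n}) f" for f
    proof -
      have "mapp n N X f (i, p) = f (sig p i, p)" if "i < N" "p < n" for i p
      proof -
        have "mapp n N X f (i, p) = (\<Sum>j<N. \<Sum>q<n. if q = p then (if j = sig p i then f (j, p) else 0) else 0)"
          unfolding mapp_def prod.case using that by (intro sum.cong refl) (auto simp: X_def)
        then show ?thesis using that s1 by simp
      qed
      then have "(cnm ({..<N} \<times> {..<n}) (mapp n N X f))\<^sup>2 =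
          (\<Sum>i<N. \<Sum>p<n. (cmod (f (sig p i, p)))\<^sup>2)"
        unfolding cnm_power2 sum.cartesian_product' by (intro sum.cong refl) auto
      also have "\<dots> = (\<Sum>p<n. \<Sum>i<N. (cmod (f (sig p i, p)))\<^sup>2)" by (rule sum.swap)
      also have "\<dots> = (\<Sum>p<n. \<Sum>i<N. (cmod (f (i, p)))\<^sup>2)"
        by (rule sum.cong[OF refl], rule sbij) simp
      also have "\<dots> = (\<Sum>i<N. \<Sum>p<n. (cmod (f (i, p)))\<^sup>2)" by (rule sum.swap)
      also have "\<dots> = (cnm ({..<N} \<times> {..<n}) f)\<^sup>2"
        unfolding cnm_power2 sum.cartesian_product' ..
      finally show ?thesis by (metis cnm_nonneg mult_1 order_refl power2_eq_imp_eq)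
    qed
    then have "os_norm (ell_infty n) N X \<le> ereal 1"
      unfolding ell_infty_def using matrix_norm_le_iff[of 1] by auto
    then show ?thesis by (simp add: one_ereal_def)
  qed
  define A where "A = (\<lambda>i j s t. if s < N \<and> t < N then efun n (\<lambda>c. e (sig c s) t) (X i j) else 0)"
  define f where "f = (\<lambda>(j :: nat, t :: nat). if j = t then complex_of_real (1 / sqrt (real N)) else 0)"
  let ?S = "{..<N} \<times> {..<N}"
  have f1: "cnm ?S f = 1"
  proof -
    have "(cnm ?S f)\<^sup>2 = (\<Sum>i<N. \<Sum>p<N. if p = i then 1 / real N else 0)"
      unfolding cnm_power2 sum.cartesian_product'
      by (intro sum.cong refl) (auto simp: f_def power_divide norm_divide)
    also have "\<dots> = 1" using N by simp
    finally show ?thesis using cnm_nonneg[of ?S f] by (simp add: power2_eq_1_iff)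
  qed
  have val: "mapp N N A f (i, i) = complex_of_real (1 / sqrt (real N)) * (\<Sum>c<n. e (sig c i) (sig c i))"
    if "i < N" for i
  proof -
    have "mapp N N A f (i, i) = (\<Sum>j<N. A i j i j * complex_of_real (1 / sqrt (real N)))"
      unfolding mapp_def prod.case
      by (intro sum.cong refl) (auto simp: f_def if_distrib[of "\<lambda>x. _ * x"] cong: if_cong)
    also have "\<dots> = (\<Sum>j<N. \<Sum>c<n. if j = sig c i then e (sig c i) j * complex_of_real (1 / sqrt (real N)) else 0)"
      unfolding A_def using that car
      by (intro sum.cong refl) (auto simp: efun_def X_def sum_divide_distrib intro!: sum.cong)
    also have "\<dots> = (\<Sum>c<n. \<Sum>j<N. if j = sig c i then e (sig c i) j * complex_of_real (1 / sqrt (real N)) else 0)"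
      by (rule sum.swap)
    also have "\<dots> = (\<Sum>c<n. e (sig c i) (sig c i) * complex_of_real (1 / sqrt (real N)))"
      using s1 that by (intro sum.cong refl) auto
    finally show ?thesis by (simp add: sum_divide_distrib)
  qed
  have "cip ?S f (mapp N N A f) = (\<Sum>i<N. complex_of_real (1 / sqrt (real N)) * mapp N N A f (i, i))"
    unfolding cip_prod
    by (intro sum.cong refl) (auto simp: f_def if_distrib[of "\<lambda>x. x * _"] if_distrib[of cnj] cong: if_cong)
  also have "\<dots> = (\<Sum>i<N. complex_of_real (1 / real N) * (\<Sum>c<n. e (sig c i) (sig c i)))"
  proof (intro sum.cong refl)
    fix i assume "i \<in> {..<N}"
    have "complex_of_real (1 / sqrt (real N)) * complex_of_real (1 / sqrt (real N)) = complex_of_real (1 / real N)"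
      by (simp flip: of_real_mult)
    then show "complex_of_real (1 / sqrt (real N)) * mapp N N A f (i, i) =
      complex_of_real (1 / real N) * (\<Sum>c<n. e (sig c i) (sig c i))"
      using val[of i] \<open>i \<in> {..<N}\<close> by (simp only: lessThan_iff mult.assoc[symmetric])
  qed
  also have "\<dots> = complex_of_real (1 / real N) * (\<Sum>c<n. \<Sum>i<N. e (sig c i) (sig c i))"
    unfolding sum_distrib_left[symmetric] by (subst sum.swap) (rule refl)
  also have "(\<Sum>c<n. \<Sum>i<N. e (sig c i) (sig c i)) = of_nat n * (\<Sum>i<N. e i i)"
    using sbij[of _ "\<lambda>i. e i i"] by simp
  finally have cip: "cip ?S f (mapp N N A f) = complex_of_real (1 / real N) * (of_nat n * (\<Sum>i<N. e i i))" .
  have "real n * mtrace N e / real N = Re (cip ?S f (mapp N N A f))"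
    unfolding cip by (simp add: mtrace_def)
  also have "\<dots> \<le> cmod (cip ?S f (mapp N N A f))" by (rule complex_Re_le_cmod)
  also have "\<dots> \<le> cnm ?S (mapp N N A f)" using cmod_cip_le[of ?S f "mapp N N A f"] f1 by simp
  finally have "ereal (real n * mtrace N e / real N) \<le> ereal (cnm ?S (mapp N N A f))" by simp
  also have "\<dots> \<le> os_norm (Mat N) N A" unfolding Mat_def using f1 by (intro matrix_norm_ge) simp
  also have "\<dots> \<le> os_norm (E1 n) N (\<lambda>v w. efun n (\<lambda>c. e (sig c v) w))"
    unfolding os_norm_E1 A_def using N car Xle by (intro SUP_upper2[of N] SUP_upper2[of X]) auto
  finally show ?thesis .
qed

section \<open>Approximation of compact operators\<close>

lift_definition trunc :: "nat \<Rightarrow> ell2 \<Rightarrow> ell2" is "\<lambda>k x i. if i < k then x i else 0"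
  by (rule summable_finite[of "{..<k}" for k]) auto

lift_definition ebas :: "nat \<Rightarrow> ell2" is "\<lambda>q i. if i = q then 1 else 0"
  by (rule summable_finite[of "{q}" for q]) auto

lemma ell2_eqI: "(\<And>i. ell2_nth x i = ell2_nth y i) \<Longrightarrow> x = y"
  by (simp add: ell2_nth_inject[symmetric] fun_eq_iff)

lemma ell2_nth_sum: "ell2_nth (\<Sum>j\<in>J. x j) i = (\<Sum>j\<in>J. ell2_nth (x j) i)"
  by (induction J rule: infinite_finite_induct) (simp_all add: zero_ell2.rep_eq plus_ell2.rep_eq)

lemma summable_ell2: "summable (\<lambda>i. (cmod (ell2_nth x i))\<^sup>2)"
  using ell2_nth[of x] by simp

lemma norm_ell2_power2: "(norm x)\<^sup>2 = (\<Sum>i. (cmod (ell2_nth x i))\<^sup>2)"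
  unfolding norm_ell2.rep_eq by (rule real_sqrt_pow2) (intro suminf_nonneg summable_ell2 zero_le_power2)

lemma norm_ell2_finite:
  assumes "\<And>i. k \<le> i \<Longrightarrow> ell2_nth x i = 0"
  shows "norm x = L2_set (\<lambda>i. cmod (ell2_nth x i)) {..<k}"
  unfolding norm_ell2.rep_eq L2_set_def
  by (subst suminf_finite[of "{..<k}"]) (auto simp: assms)

lemma sum_coords_le: "finite A \<Longrightarrow> (\<Sum>i\<in>A. (cmod (ell2_nth x i))\<^sup>2) \<le> (norm x)\<^sup>2"
  unfolding norm_ell2_power2 by (intro sum_le_suminf summable_ell2) auto

lemma norm_ell2_mono:
  assumes "\<And>i. cmod (ell2_nth x i) \<le> cmod (ell2_nth y i)"
  shows "norm x \<le> norm y"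
proof -
  have "(norm x)\<^sup>2 \<le> (norm y)\<^sup>2"
    unfolding norm_ell2_power2 by (intro suminf_le summable_ell2 power_mono assms) auto
  then show ?thesis by (rule power2_le_imp_le) simp
qed

lemma norm_trunc_le: "norm (trunc k x) \<le> norm x"
  by (rule norm_ell2_mono) (simp add: trunc.rep_eq)

lemma norm_minus_trunc_le: "norm (x - trunc k x) \<le> norm x"
  by (rule norm_ell2_mono) (simp add: trunc.rep_eq minus_ell2.rep_eq)

lemma trunc_diff: "trunc k (x - y) = trunc k x - trunc k y"
  by (rule ell2_eqI) (simp add: trunc.rep_eq minus_ell2.rep_eq)

lemma trunc_scaleR: "trunc k (r *\<^sub>R x) = r *\<^sub>R trunc k x"
  by (rule ell2_eqI) (simp add: trunc.rep_eq scaleR_ell2.rep_eq)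

lemma trunc_trunc: "l \<le> k \<Longrightarrow> trunc k (trunc l x) = trunc l x"
  by (rule ell2_eqI) (simp add: trunc.rep_eq)

lemma trunc_eq_sum: "trunc k x = (\<Sum>q<k. ell2_nth x q *\<^sub>C ebas q)"
  by (rule ell2_eqI)
    (simp add: trunc.rep_eq ell2_nth_sum scaleC_ell2.rep_eq ebas.rep_eq if_distrib[of "\<lambda>x. _ * x"] cong: if_cong)

lemma norm_trunc: "norm (trunc k x) = L2_set (\<lambda>i. cmod (ell2_nth x i)) {..<k}"
  by (subst norm_ell2_finite[of k]) (auto simp: trunc.rep_eq intro!: L2_set_cong)

lemma trunc_tendsto: "(\<lambda>k. trunc k x) \<longlonglongrightarrow> x"
proof -
  let ?f = "\<lambda>i. (cmod (ell2_nth x i))\<^sup>2"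
  have eq: "(norm (trunc k x - x))\<^sup>2 = suminf ?f - sum ?f {..<k}" for k
  proof -
    have s: "summable (\<lambda>i. if i < k then ?f i else 0)" by (rule summable_finite[of "{..<k}"]) auto
    have "(norm (trunc k x - x))\<^sup>2 = (\<Sum>i. ?f i - (if i < k then ?f i else 0))"
      unfolding norm_ell2_power2 by (intro suminf_cong) (auto simp: minus_ell2.rep_eq trunc.rep_eq)
    also have "\<dots> = suminf ?f - (\<Sum>i. if i < k then ?f i else 0)"
      by (rule suminf_diff[symmetric]) (rule summable_ell2, rule s)
    also have "(\<Sum>i. if i < k then ?f i else 0) = sum ?f {..<k}"
      by (subst suminf_finite[of "{..<k}"]) auto
    finally show ?thesis .
  qed
  have "(\<lambda>k. suminf ?f - sum ?f {..<k}) \<longlonglongrightarrow> suminf ?f - suminf ?f"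
    by (intro tendsto_intros summable_LIMSEQ summable_ell2)
  then have "(\<lambda>k. (norm (trunc k x - x))\<^sup>2) \<longlonglongrightarrow> 0" by (simp add: eq)
  then have "(\<lambda>k. sqrt ((norm (trunc k x - x))\<^sup>2)) \<longlonglongrightarrow> sqrt 0" by (rule tendsto_real_sqrt)
  then show ?thesis by (simp add: tendsto_norm_zero_iff LIM_zero_iff)
qed

text \<open>The image of the unit ball is covered by finitely many balls of radius
  \<open>\<eta>/2\<close>. Truncation converges at their centres, and the rest follows because
  \<open>1 - trunc k\<close> is a contraction.\<close>

lemma compact_trunc_left:
  assumes a: "a \<in> compact_operators" and \<eta>: "0 < \<eta>"
  shows "\<exists>K. \<forall>k\<ge>K. \<forall>x. norm (blinfun_apply a x - trunc k (blinfun_apply a x)) \<le> \<eta> * norm x"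
proof -
  let ?S = "closure (blinfun_apply a ` cball 0 1)"
  have "compact ?S" using a by (simp add: compact_operators_def)
  then obtain T where T: "finite T" "?S \<subseteq> (\<Union>y\<in>T. ball y (\<eta>/2))"
    using \<eta> unfolding compact_eq_totally_bounded by (meson half_gt_zero)
  have "\<forall>y\<in>T. \<forall>\<^sub>F k in sequentially. dist (trunc k y) y < \<eta>/2"
    using tendstoD[OF trunc_tendsto half_gt_zero[OF \<eta>]] by blast
  then have "\<forall>\<^sub>F k in sequentially. \<forall>y\<in>T. dist (trunc k y) y < \<eta>/2"
    by (rule eventually_ball_finite[OF T(1)])
  then obtain K where K: "\<And>k y. k \<ge> K \<Longrightarrow> y \<in> T \<Longrightarrow> dist (trunc k y) y < \<eta>/2"
    by (auto simp: eventually_sequentially)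
  have unit: "norm (blinfun_apply a x - trunc k (blinfun_apply a x)) \<le> \<eta>" if k: "k \<ge> K" and x: "norm x \<le> 1" for k x
  proof -
    define z where "z = blinfun_apply a x"
    have "z \<in> ?S" unfolding z_def using x by (intro closure_subset[THEN subsetD]) auto
    then obtain y where y: "y \<in> T" "dist y z < \<eta>/2" using T(2) by auto
    have "z - trunc k z = ((z - y) - trunc k (z - y)) + (y - trunc k y)"
      by (simp add: trunc_diff)
    then have "norm (z - trunc k z) \<le> norm ((z - y) - trunc k (z - y)) + norm (y - trunc k y)"
      by (metis norm_triangle_ineq)
    also have "\<dots> \<le> norm (z - y) + norm (y - trunc k y)"
      by (intro add_right_mono norm_minus_trunc_le)
    also have "\<dots> \<le> \<eta>"
      using y(2) K[OF k y(1)] by (simp add: dist_norm norm_minus_commute)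
    finally show ?thesis by (simp add: z_def)
  qed
  have "norm (blinfun_apply a x - trunc k (blinfun_apply a x)) \<le> \<eta> * norm x" if k: "k \<ge> K" for k x
  proof (cases "x = 0")
    case True
    then show ?thesis using norm_minus_trunc_le[of 0 k] by simp
  next
    case False
    let ?r = "inverse (norm x)"
    have "norm (blinfun_apply a (?r *\<^sub>R x) - trunc k (blinfun_apply a (?r *\<^sub>R x))) \<le> \<eta>"
      using False by (intro unit k) simp
    then have "norm (?r *\<^sub>R (blinfun_apply a x - trunc k (blinfun_apply a x))) \<le> \<eta>"
      by (simp add: blinfun.scaleR_right trunc_scaleR scaleR_diff_right)
    then have "inverse (norm x) * norm (blinfun_apply a x - trunc k (blinfun_apply a x)) \<le> \<eta>"
      unfolding norm_scaleR by simp
    then show ?thesis using False by (simp add: field_simps)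
  qed
  then show ?thesis by blast
qed

text \<open>Riesz representation by hand: the coefficients of \<open>\<phi>\<close> are square
  summable, and Cauchy-Schwarz bounds \<open>\<phi>\<close> beyond \<open>k\<close> by their
  tail.\<close>

lemma functional_trunc_tail:
  fixes \<phi> :: "ell2 \<Rightarrow> complex"
  assumes lin: "clinear_on UNIV \<phi>" and bd: "\<And>x. cmod (\<phi> x) \<le> B * norm x" and \<eta>: "0 < \<eta>"
  shows "\<exists>K. \<forall>k\<ge>K. \<forall>x. cmod (\<phi> (x - trunc k x)) \<le> \<eta> * norm x"
proof -
  have add: "\<phi> (x + y) = \<phi> x + \<phi> y" and scale: "\<phi> (c *\<^sub>C x) = c * \<phi> x" for x y c
    using lin by (auto simp: clinear_on_def scaleC_complex_def)
  have zero: "\<phi> 0 = 0" using add[of 0 0] by simp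
  have diff: "\<phi> (x - y) = \<phi> x - \<phi> y" for x y
    using add[of "x - y" y] by (simp add: algebra_simps)
  have sum: "\<phi> (\<Sum>j\<in>J. x j) = (\<Sum>j\<in>J. \<phi> (x j))" for J and x :: "nat \<Rightarrow> ell2"
    by (induction J rule: infinite_finite_induct) (simp_all add: zero add)
  define c where "c q = \<phi> (ebas q)" for q
  have tr: "\<phi> (trunc Q x) = (\<Sum>q<Q. ell2_nth x q * c q)" for Q x
    by (simp add: trunc_eq_sum sum scale c_def)
  have part: "(\<Sum>q<Q. (cmod (c q))\<^sup>2) \<le> B\<^sup>2" for Q
  proof -
    \<comment> \<open>Here \<open>\<phi>\<close> takes the value \<open>?T\<close> at a vector of
      norm \<open>sqrt ?T\<close>, so \<open>sqrt ?T \<le> B\<close> unless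
      \<open>?T = 0\<close>.\<close>
    define v where "v = (\<Sum>q<Q. cnj (c q) *\<^sub>C ebas q)"
    let ?T = "\<Sum>q<Q. (cmod (c q))\<^sup>2"
    have vn: "ell2_nth v i = (if i < Q then cnj (c i) else 0)" for i
      by (simp add: v_def ell2_nth_sum scaleC_ell2.rep_eq ebas.rep_eq if_distrib[of "\<lambda>x. _ * x"] cong: if_cong)
    have nv: "norm v = sqrt ?T"
      using norm_ell2_finite[of Q v] by (simp add: vn L2_set_def)
    have T0: "0 \<le> ?T" by (intro sum_nonneg) simp
    have "\<phi> v = complex_of_real ?T"
      by (simp add: v_def sum scale c_def[symmetric] complex_norm_square[symmetric] mult.commute)
    then have "cmod (\<phi> v) = ?T" using T0 by (simp only: norm_of_real abs_of_nonneg)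
    then have "sqrt ?T * sqrt ?T \<le> B * sqrt ?T" using bd[of v] nv T0 by (simp only: real_sqrt_mult_self abs_of_nonneg)
    then have "sqrt ?T \<le> B \<or> sqrt ?T = 0"
      using real_sqrt_ge_zero[OF T0] mult_right_le_imp_le[of "sqrt ?T" "sqrt ?T" B] by linarith
    then show ?thesis
    proof
      assume "sqrt ?T = 0"
      then have "?T = 0" by (simp only: real_sqrt_eq_0_iff)
      then show ?thesis by (simp only: zero_le_power2)
    qed (rule sqrt_le_D)
  qed
  have "summable (\<lambda>q. (cmod (c q))\<^sup>2)"
    by (rule summableI_nonneg_bounded[of _ "B\<^sup>2"]) (use part in auto)
  then obtain K where K: "\<And>k Q. k \<ge> K \<Longrightarrow> (\<Sum>q\<in>{k..<Q}. (cmod (c q))\<^sup>2) < \<eta>\<^sup>2"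
  proof -
    have "\<eta>\<^sup>2 > 0" using \<eta> by simp
    then obtain K where "\<And>k Q. k \<ge> K \<Longrightarrow> norm (\<Sum>q\<in>{k..<Q}. (cmod (c q))\<^sup>2) < \<eta>\<^sup>2"
      using \<open>summable _\<close> unfolding summable_Cauchy by blast
    then have "\<And>k Q. k \<ge> K \<Longrightarrow> (\<Sum>q\<in>{k..<Q}. (cmod (c q))\<^sup>2) < \<eta>\<^sup>2"
      by (simp add: sum_nonneg)
    then show ?thesis using that by blast
  qed
  have "cmod (\<phi> (x - trunc k x)) \<le> \<eta> * norm x" if k: "k \<ge> K" for k x
  proof -
    have le: "cmod (\<phi> (trunc Q x) - \<phi> (trunc k x)) \<le> \<eta> * norm x" if "Q \<ge> k" for Q
    proof -
      have "\<phi> (trunc Q x) - \<phi> (trunc k x) = (\<Sum>q\<in>{k..<Q}. ell2_nth x q * c q)"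
        unfolding tr lessThan_atLeast0
        using sum.atLeastLessThan_concat[of 0 k Q "\<lambda>q. ell2_nth x q * c q"] that
        by (simp add: algebra_simps)
      then have "cmod (\<phi> (trunc Q x) - \<phi> (trunc k x)) \<le>
          (\<Sum>q\<in>{k..<Q}. \<bar>cmod (c q)\<bar> * \<bar>cmod (ell2_nth x q)\<bar>)"
        by (auto simp: norm_mult mult.commute intro!: order_trans[OF norm_sum])
      also have "\<dots> \<le> L2_set (\<lambda>q. cmod (c q)) {k..<Q} * L2_set (\<lambda>q. cmod (ell2_nth x q)) {k..<Q}"
        by (rule L2_set_mult_ineq)
      also have "\<dots> \<le> \<eta> * norm x"
      proof (intro mult_mono)
        show "L2_set (\<lambda>q. cmod (c q)) {k..<Q} \<le> \<eta>"
          unfolding L2_set_def using K[OF k, of Q] \<eta> by (intro real_le_lsqrt) auto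
        show "L2_set (\<lambda>q. cmod (ell2_nth x q)) {k..<Q} \<le> norm x"
          unfolding L2_set_def using sum_coords_le[of "{k..<Q}" x] by (intro real_le_lsqrt) auto
      qed (use \<eta> in auto)
      finally show ?thesis .
    qed
    \<comment> \<open>The bounds for finite \<open>Q\<close> pass to \<open>x\<close> in the
      limit.\<close>
    have "(\<lambda>Q. \<phi> (trunc Q x)) \<longlonglongrightarrow> \<phi> x"
    proof -
      have "(\<lambda>Q. norm (trunc Q x - x)) \<longlonglongrightarrow> 0"
        using trunc_tendsto[of x] by (simp add: LIM_zero_iff tendsto_norm_zero_iff)
      then have "(\<lambda>Q. B * norm (trunc Q x - x)) \<longlonglongrightarrow> 0"
        using tendsto_mult_right_zero by blast
      then have "(\<lambda>Q. \<phi> (trunc Q x) - \<phi> x) \<longlonglongrightarrow> 0"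
        by (rule Lim_null_comparison[rotated]) (simp add: diff[symmetric] bd)
      then show ?thesis by (simp add: LIM_zero_iff)
    qed
    then have "(\<lambda>Q. cmod (\<phi> (trunc Q x) - \<phi> (trunc k x))) \<longlonglongrightarrow> cmod (\<phi> x - \<phi> (trunc k x))"
      by (intro tendsto_intros)
    then have "cmod (\<phi> x - \<phi> (trunc k x)) \<le> \<eta> * norm x"
      by (rule LIMSEQ_le_const2) (use le in blast)
    then show ?thesis by (simp add: diff)
  qed
  then show ?thesis by blast
qed

lemma cmod_ell2_nth_le: "cmod (ell2_nth x i) \<le> norm x"
  by (rule power2_le_imp_le) (use sum_coords_le[of "{i}" x] in auto)

lemma norm_trunc_le_sum: "norm (trunc k x) \<le> (\<Sum>i<k. cmod (ell2_nth x i))"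
  unfolding norm_trunc by (rule L2_set_le_sum) simp

text \<open>Truncation on the right is reduced to functionals, which takes the place of compactness
  of the adjoint: after a left truncation at a fixed \<open>l\<close> only \<open>l\<close>
  coordinates of \<open>a\<close> remain, each with a small tail.\<close>

lemma compact_approx:
  assumes a: "a \<in> compact_operators" and \<eta>: "0 < \<eta>"
  shows "\<exists>K. \<forall>k\<ge>K. \<forall>x. norm (blinfun_apply a x - trunc k (blinfun_apply a (trunc k x))) \<le> \<eta> * norm x"
proof -
  have lin: "clinear_on UNIV (blinfun_apply a)" using a by (simp add: compact_operators_def)
  obtain l where l: "\<And>k x. k \<ge> l \<Longrightarrow> norm (blinfun_apply a x - trunc k (blinfun_apply a x)) \<le> \<eta>/3 * norm x"
    using compact_trunc_left[OF a, of "\<eta>/3"] \<eta> by auto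
  \<comment> \<open>The \<open>l\<close> coordinates, each with error \<open>\<epsilon>\<close>, add
    up to at most \<open>\<eta>/3\<close>; the \<open>+ 1\<close> covers
    \<open>l = 0\<close>.\<close>
  define \<epsilon> where "\<epsilon> = \<eta> / (3 * (real l + 1))"
  have \<epsilon>: "0 < \<epsilon>" "real l * \<epsilon> \<le> \<eta>/3" using \<eta> by (auto simp: \<epsilon>_def field_simps)
  have "\<exists>K. \<forall>k\<ge>K. \<forall>x. cmod (ell2_nth (blinfun_apply a (x - trunc k x)) j) \<le> \<epsilon> * norm x" for j
  proof (rule functional_trunc_tail[where \<phi> = "\<lambda>x. ell2_nth (blinfun_apply a x) j" and B = "norm a"])
    show "clinear_on UNIV (\<lambda>x. ell2_nth (blinfun_apply a x) j)"
      using lin by (simp add: clinear_on_def plus_ell2.rep_eq scaleC_ell2.rep_eq scaleC_complex_def)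
    show "cmod (ell2_nth (blinfun_apply a x) j) \<le> norm a * norm x" for x
      using cmod_ell2_nth_le norm_blinfun order_trans by blast
  qed (rule \<epsilon>)
  then obtain Kj where Kj: "\<And>j k x. k \<ge> Kj j \<Longrightarrow> cmod (ell2_nth (blinfun_apply a (x - trunc k x)) j) \<le> \<epsilon> * norm x"
    by metis
  define K where "K = max l (Max (insert 0 (Kj ` {..<l})))"
  have "norm (blinfun_apply a x - trunc k (blinfun_apply a (trunc k x))) \<le> \<eta> * norm x" if k: "k \<ge> K" for k x
  proof -
    have kl: "l \<le> k" and kj: "j < l \<Longrightarrow> Kj j \<le> k" for j
      using k by (auto simp: K_def)
    define w where "w = blinfun_apply a (trunc k x)"
    \<comment> \<open>The three errors are the left cut at \<open>l\<close> for \<open>x\<close>,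
      the right cut seen through \<open>l\<close> coordinates, and the left cut at \<open>l\<close>
      for \<open>trunc k x\<close>.\<close>
    have "blinfun_apply a x - trunc k w = (blinfun_apply a x - trunc l (blinfun_apply a x))
        + trunc l (blinfun_apply a (x - trunc k x)) - trunc k (w - trunc l w)"
      by (simp add: trunc_diff blinfun.diff_right trunc_trunc[OF kl] w_def)
    then have "norm (blinfun_apply a x - trunc k w) \<le> norm (blinfun_apply a x - trunc l (blinfun_apply a x))
        + norm (trunc l (blinfun_apply a (x - trunc k x))) + norm (trunc k (w - trunc l w))"
      using norm_triangle_ineq norm_triangle_ineq4 by (smt (verit))
    moreover have "norm (blinfun_apply a x - trunc l (blinfun_apply a x)) \<le> \<eta>/3 * norm x"
      by (rule l) simp
    moreover have "norm (trunc l (blinfun_apply a (x - trunc k x))) \<le> (\<Sum>j<l. \<epsilon> * norm x)"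
      using Kj kj by (intro order_trans[OF norm_trunc_le_sum] sum_mono) auto
    moreover have "(\<Sum>j<l. \<epsilon> * norm x) \<le> \<eta>/3 * norm x"
      using mult_right_mono[OF \<epsilon>(2) norm_ge_zero[of x]] by simp
    moreover have "norm (trunc k (w - trunc l w)) \<le> norm (w - trunc l w)" by (rule norm_trunc_le)
    moreover have "norm (w - trunc l w) \<le> \<eta>/3 * norm (trunc k x)" unfolding w_def by (rule l) simp
    moreover have "\<eta>/3 * norm (trunc k x) \<le> \<eta>/3 * norm x"
      using \<eta> by (intro mult_left_mono norm_trunc_le) auto
    ultimately have "norm (blinfun_apply a x - trunc k w) \<le> \<eta>/3 * norm x + \<eta>/3 * norm x + \<eta>/3 * norm x"
      by linarith
    then show ?thesis by (simp add: w_def)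
  qed
  then show ?thesis by blast
qed

section \<open>Maps into the compact operators\<close>

lemma L2_set_L2_set_cnm: "L2_set (\<lambda>v. L2_set (\<lambda>p. cmod (F (p, v))) A) B = cnm (A \<times> B) F"
  unfolding cnm_def L2_set_def sum.cartesian_product'
  by (subst sum.swap) (simp add: sum_nonneg)

lemma concrete_norm_ge:
  assumes "L2_set (\<lambda>j. norm (x j)) {..<l} \<le> 1"
  shows "ereal (L2_set (\<lambda>i. norm (\<Sum>j<l. blinfun_apply (A i j) (x j))) {..<l})
    \<le> os_norm (concrete_opspace F) l A"
  unfolding concrete_opspace_def using assms by (auto intro!: SUP_upper)

lemma concrete_norm_apply_le:
  assumes A: "os_norm (concrete_opspace F) l A \<le> ereal r" and r: "0 \<le> r"
  shows "L2_set (\<lambda>i. norm (\<Sum>j<l. blinfun_apply (A i j) (x j))) {..<l} \<le> r * L2_set (\<lambda>j. norm (x j)) {..<l}"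
proof -
  let ?n = "L2_set (\<lambda>j. norm (x j)) {..<l}"
  have n0: "0 \<le> ?n" by simp
  show ?thesis
  proof (cases "?n = 0")
    case True
    then have "x j = 0" if "j < l" for j using that by (simp add: L2_set_eq_0_iff)
    then have "(\<Sum>j<l. blinfun_apply (A i j) (x j)) = 0" for i
      by (intro sum.neutral) (simp add: blinfun.zero_right)
    then show ?thesis using True by (simp add: L2_set_def)
  next
    case False
    then have pos: "0 < ?n" using n0 by linarith
    define y where "y j = (1 / ?n) *\<^sub>R x j" for j
    have "L2_set (\<lambda>j. norm (y j)) {..<l} = (1 / ?n) * ?n"
      unfolding y_def norm_scaleR using pos by (subst L2_set_right_distrib) auto
    then have "L2_set (\<lambda>j. norm (y j)) {..<l} \<le> 1" using pos by simp
    from order_trans[OF concrete_norm_ge[OF this] A]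
    have "L2_set (\<lambda>i. norm (\<Sum>j<l. blinfun_apply (A i j) (y j))) {..<l} \<le> r" by simp
    moreover have "(\<Sum>j<l. blinfun_apply (A i j) (y j)) = (1 / ?n) *\<^sub>R (\<Sum>j<l. blinfun_apply (A i j) (x j))" for i
      by (simp add: y_def blinfun.scaleR_right scaleR_sum_right)
    ultimately have "(1 / ?n) * L2_set (\<lambda>i. norm (\<Sum>j<l. blinfun_apply (A i j) (x j))) {..<l} \<le> r"
      using pos by (subst L2_set_right_distrib) auto
    then show ?thesis using pos by (simp add: field_simps)
  qed
qed

lemma concrete_norm_leI:
  assumes "\<And>x. L2_set (\<lambda>i. norm (\<Sum>j<l. blinfun_apply (A i j) (x j))) {..<l} \<le> L2_set (\<lambda>j. norm (x j)) {..<l}"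
  shows "os_norm (concrete_opspace F) l A \<le> 1"
  unfolding concrete_opspace_def opspace.simps
proof (rule SUP_least)
  fix x :: "nat \<Rightarrow> ell2" assume "x \<in> {x. L2_set (\<lambda>j. norm (x j)) {..<l} \<le> 1}"
  then have "L2_set (\<lambda>i. norm (\<Sum>j<l. blinfun_apply (A i j) (x j))) {..<l} \<le> 1"
    using assms[of x] by simp
  then show "ereal (L2_set (\<lambda>i. norm (\<Sum>j<l. blinfun_apply (A i j) (x j))) {..<l}) \<le> 1"
    by (simp add: one_ereal_def)
qed

lemma E1_norm_scale_le:
  assumes "os_norm (E1 n) m Z \<le> ereal r" "0 \<le> r" "0 \<le> z"
  shows "os_norm (E1 n) m (\<lambda>s t x. complex_of_real z * Z s t x) \<le> ereal (z * r)"
  unfolding os_norm_E1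
proof (intro SUP_least)
  fix l :: nat and X :: "nat \<Rightarrow> nat \<Rightarrow> nat \<Rightarrow> nat \<Rightarrow> complex"
  assume l: "l \<in> {1..}"
    and X: "X \<in> {X. (\<forall>i<l. \<forall>j<l. X i j \<in> os_carrier (ell_infty n)) \<and> os_norm (ell_infty n) l X \<le> 1}"
  let ?A = "\<lambda>i j s t. if s < m \<and> t < m then Z s t (X i j) else 0"
  have "os_norm (Mat m) l ?A \<le> os_norm (E1 n) m Z"
    unfolding os_norm_E1 by (rule SUP_upper2[OF l], rule SUP_upper2[OF X]) simp
  also note assms(1)
  finally have "cnm ({..<l} \<times> {..<m}) (mapp m l ?A f) \<le> r * cnm ({..<l} \<times> {..<m}) f" for f
    unfolding Mat_def matrix_norm_le_iff[OF assms(2)] by blast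
  then have "z * cnm ({..<l} \<times> {..<m}) (mapp m l ?A f) \<le> z * r * cnm ({..<l} \<times> {..<m}) f" for f
    using mult_left_mono[OF _ assms(3)] by (simp add: mult.assoc)
  moreover have "mapp m l (\<lambda>i j s t. if s < m \<and> t < m then complex_of_real z * Z s t (X i j) else 0) f
      = (\<lambda>p. complex_of_real z * mapp m l ?A f p)" for f
    by (auto simp: mapp_def fun_eq_iff sum_distrib_left mult.assoc intro!: sum.cong)
  ultimately show "os_norm (Mat m) l (\<lambda>i j s t. if s < m \<and> t < m then complex_of_real z * Z s t (X i j) else 0)
      \<le> ereal (z * r)"
    using assms unfolding Mat_def by (subst matrix_norm_le_iff) (auto simp: cnm_scale)
qed

lemma cb_norm_ge:
  assumes "1 \<le> l" "\<And>i j. i < l \<Longrightarrow> j < l \<Longrightarrow> X i j \<in> os_carrier E" "os_norm E l X \<le> 1"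
  shows "os_norm F l (\<lambda>i j. u (X i j)) \<le> cb_norm E F u"
  unfolding cb_norm_def using assms by (intro SUP_upper2[of l] SUP_upper2[of X]) auto

lemma scaleC_zero_left [simp]: "0 *\<^sub>C x = (0::'a::complex_vector)"
  using scaleC_add_left[of 0 0 x] by simp

text \<open>Linearity is available on the carrier only, so the induction adds one coordinate at a
  time and stays among the \<open>efun\<close>.\<close>

lemma clinear_efun:
  fixes u :: "((nat \<Rightarrow> nat \<Rightarrow> complex) \<Rightarrow> complex) \<Rightarrow> 'b::complex_vector"
  assumes "clinear_on (os_carrier (E1 n)) u"
  shows "u (efun n t) = (\<Sum>c<n. t c *\<^sub>C u (efun n (cdelta c)))"
proof -
  have eadd: "efun n s + efun n t = efun n (\<lambda>c. s c + t c)" for s t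
    by (rule ext) (simp add: efun_def algebra_simps sum.distrib)
  have escale: "a *\<^sub>C efun n t = efun n (\<lambda>c. a * t c)" for a t
    by (rule ext) (simp add: efun_def scaleC_fun_def scaleC_complex_def sum_distrib_left mult.assoc)
  have uadd: "u (efun n (\<lambda>c. s c + t c)) = u (efun n s) + u (efun n t)" for s t
    using assms efun_in_carrier unfolding clinear_on_def eadd[symmetric] by blast
  have uscale: "u (efun n (\<lambda>c. a * t c)) = a *\<^sub>C u (efun n t)" for a t
    using assms efun_in_carrier unfolding clinear_on_def escale[symmetric] by blast
  have ind: "u (efun n (\<lambda>c. if c < l then t c else 0)) = (\<Sum>c<l. t c *\<^sub>C u (efun n (cdelta c)))" for l
  proof (induction l)
    case 0
    then show ?case using uscale[of 0 t] by simp
  next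
    case (Suc l)
    have "(\<lambda>c. if c < Suc l then t c else 0) = (\<lambda>c. (if c < l then t c else 0) + t l * cdelta l c)"
      by (auto simp: cdelta_def less_Suc_eq)
    then show ?case by (simp only: uadd uscale Suc sum.lessThan_Suc)
  qed
  have "efun n t = efun n (\<lambda>c. if c < n then t c else 0)"
    by (rule ext) (simp add: efun_def)
  then show ?thesis using ind[of n] by simp
qed

text \<open>The projection acts on each coordinate of \<open>ell2\<close> separately;
  \<open>cnm_amp_le\<close> with \<open>k = 1\<close> settles one coordinate, and the squares are
  summed.\<close>

lemma hproj_ell2_contraction:
  fixes x :: "nat \<Rightarrow> ell2"
  assumes "hproj N e"
  shows "L2_set (\<lambda>v. norm (\<Sum>w<N. e v w *\<^sub>C x w)) {..<N} \<le> L2_set (\<lambda>w. norm (x w)) {..<N}"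
proof -
  have sm: "summable (\<lambda>i. (cmod (ell2_nth y i))\<^sup>2)" for y by (rule summable_ell2)
  have sq: "(\<Sum>v<N. (norm (y v))\<^sup>2) = (\<Sum>i. \<Sum>v<N. (cmod (ell2_nth (y v) i))\<^sup>2)" for y
    unfolding norm_ell2_power2 by (rule suminf_sum[symmetric]) (rule sm)
  have le: "(\<Sum>v<N. (cmod (ell2_nth (\<Sum>w<N. e v w *\<^sub>C x w) i))\<^sup>2) \<le> (\<Sum>w<N. (cmod (ell2_nth (x w) i))\<^sup>2)" for i
  proof -
    define f where "f = (\<lambda>(p::nat, w). ell2_nth (x w) i)"
    have "(cnm ({..<1} \<times> {..<N}) (amp N e f))\<^sup>2 \<le> (cnm ({..<1} \<times> {..<N}) f)\<^sup>2"
      by (intro power_mono cnm_amp_le[OF assms] cnm_nonneg)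
    then show ?thesis
      unfolding cnm_power2 sum.cartesian_product'
      by (simp add: amp_def mv_def f_def ell2_nth_sum scaleC_ell2.rep_eq)
  qed
  have "(\<Sum>v<N. (norm (\<Sum>w<N. e v w *\<^sub>C x w))\<^sup>2) \<le> (\<Sum>w<N. (norm (x w))\<^sup>2)"
    unfolding sq by (intro suminf_le le summable_sum sm)
  then show ?thesis unfolding L2_set_def by (rule real_sqrt_le_mono)
qed

definition mat_entries :: "(nat \<Rightarrow> ell2 \<Rightarrow>\<^sub>L ell2) \<Rightarrow> nat \<Rightarrow> nat \<Rightarrow> nat \<Rightarrow> complex" where
  "mat_entries a c p q = ell2_nth (blinfun_apply (a c) (ebas q)) p"

lemma clinear_blinfun_sum:
  assumes "clinear_on UNIV (blinfun_apply a)"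
  shows "blinfun_apply a (\<Sum>q\<in>J. t q *\<^sub>C x q) = (\<Sum>q\<in>J. t q *\<^sub>C blinfun_apply a (x q))"
  using assms by (simp add: blinfun.sum_right clinear_on_def)

lemma mat_entries_apply:
  assumes "clinear_on UNIV (blinfun_apply (a c))"
  shows "ell2_nth (blinfun_apply (a c) (\<Sum>q<k. t q *\<^sub>C ebas q)) p = (\<Sum>q<k. mat_entries a c p q * t q)"
  by (simp add: clinear_blinfun_sum[OF assms] ell2_nth_sum scaleC_ell2.rep_eq mat_entries_def mult.commute)

lemma L2_set_partial_involution:
  assumes "partial_involutions n N (\<lambda>_ _. True) sig" "c < n"
  shows "L2_set (\<lambda>v. g (sig c v)) {..<N} = L2_set g {..<N}"
proof -
  have "(\<Sum>v<N. (g (sig c v))\<^sup>2) = (\<Sum>v<N. (g v)\<^sup>2)"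
    using sum_partial_involution[OF assms, of "\<lambda>s t. (g t)\<^sup>2"] by simp
  then show ?thesis by (simp add: L2_set_def)
qed

text \<open>Each \<open>a c\<close> is its \<open>k \<times> k\<close> corner plus an error of norm
  at most \<open>\<eta>\<close>. The corners make up \<open>cop\<close>, bounded by \<open>C\<close>
  after the cut; every colour adds one \<open>\<eta>\<close>, since \<open>sig c\<close> preserves
  norms and \<open>e\<close> does not increase them.\<close>

lemma compact_tensor_cut_bound:
  fixes a :: "nat \<Rightarrow> ell2 \<Rightarrow>\<^sub>L ell2" and x :: "nat \<Rightarrow> ell2"
  assumes lin: "\<And>c. c < n \<Longrightarrow> clinear_on UNIV (blinfun_apply (a c))"
    and approx: "\<And>c x. c < n \<Longrightarrow>
      norm (blinfun_apply (a c) x - trunc k (blinfun_apply (a c) (trunc k x))) \<le> \<eta> * norm x"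
    and sig: "partial_involutions n N (\<lambda>_ _. True) sig" and e: "hproj N e"
    and C: "0 \<le> C" "\<And>f. cnm ({..<k} \<times> {..<N}) (cop n k (\<lambda>_ _. True) sig (mat_entries a) (amp N e f))
      \<le> C * cnm ({..<k} \<times> {..<N}) f"
    and \<eta>: "0 \<le> \<eta>"
  shows "L2_set (\<lambda>v. norm (\<Sum>c<n. blinfun_apply (a c) (\<Sum>w<N. e (sig c v) w *\<^sub>C x w))) {..<N}
    \<le> (C + real n * \<eta>) * L2_set (\<lambda>w. norm (x w)) {..<N}"
proof -
  define y where "y v = (\<Sum>w<N. e v w *\<^sub>C x w)" for v
  define g where "g v = (\<Sum>c<n. trunc k (blinfun_apply (a c) (trunc k (y (sig c v)))))" for v
  define d where "d c z = blinfun_apply (a c) z - trunc k (blinfun_apply (a c) (trunc k z))" for c z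
  let ?X = "L2_set (\<lambda>w. norm (x w)) {..<N}"
  have ynorm: "L2_set (\<lambda>v. norm (y v)) {..<N} \<le> ?X"
    unfolding y_def by (rule hproj_ell2_contraction[OF e])
  have split: "(\<Sum>c<n. blinfun_apply (a c) (y (sig c v))) = g v + (\<Sum>c<n. d c (y (sig c v)))" for v
    by (simp add: g_def d_def sum_subtractf)
  have D: "L2_set (\<lambda>v. norm (\<Sum>c<n. d c (y (sig c v)))) {..<N} \<le> real n * \<eta> * ?X"
  proof -
    have "L2_set (\<lambda>v. norm (\<Sum>c<n. d c (y (sig c v)))) {..<N} \<le>
        (\<Sum>c<n. L2_set (\<lambda>v. norm (d c (y (sig c v)))) {..<N})"
      by (rule L2_set_norm_sum_le) simp
    also have "\<dots> \<le> (\<Sum>c<n. \<eta> * ?X)"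
    proof (rule sum_mono)
      fix c assume "c \<in> {..<n}"
      then have c: "c < n" by simp
      have "L2_set (\<lambda>v. norm (d c (y (sig c v)))) {..<N} \<le> L2_set (\<lambda>v. \<eta> * norm (y (sig c v))) {..<N}"
        unfolding d_def by (intro L2_set_mono approx[OF c] norm_ge_zero)
      also have "\<dots> = \<eta> * L2_set (\<lambda>v. norm (y (sig c v))) {..<N}"
        using \<eta> by (simp add: L2_set_right_distrib)
      also have "\<dots> = \<eta> * L2_set (\<lambda>v. norm (y v)) {..<N}"
        using L2_set_partial_involution[OF sig c, of "\<lambda>v. norm (y v)"] by simp
      also have "\<dots> \<le> \<eta> * ?X" by (intro mult_left_mono ynorm \<eta>)
      finally show "L2_set (\<lambda>v. norm (d c (y (sig c v)))) {..<N} \<le> \<eta> * ?X" .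
    qed
    finally show ?thesis by simp
  qed
  define f where "f = (\<lambda>(q, w). ell2_nth (x w) q)"
  have gn: "norm (g v) = L2_set (\<lambda>p. cmod (cop n k (\<lambda>_ _. True) sig (mat_entries a) (amp N e f) (p, v))) {..<k}" for v
  proof -
    have "ell2_nth (g v) p = (if p < k then cop n k (\<lambda>_ _. True) sig (mat_entries a) (amp N e f) (p, v) else 0)" for p
    proof -
      have "ell2_nth (blinfun_apply (a c) (trunc k (y (sig c v)))) p =
          (\<Sum>q<k. mat_entries a c p q * amp N e f (q, sig c v))" if "c < n" for c
        unfolding trunc_eq_sum mat_entries_apply[where a = a and c = c, OF lin[OF that]]
        by (simp add: amp_def mv_def f_def y_def ell2_nth_sum scaleC_ell2.rep_eq)
      then show ?thesis by (simp add: g_def ell2_nth_sum trunc.rep_eq cop_def)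
    qed
    then show ?thesis using norm_ell2_finite[of k "g v"] by (auto intro!: L2_set_cong)
  qed
  have "L2_set (\<lambda>v. norm (g v)) {..<N} =
      cnm ({..<k} \<times> {..<N}) (cop n k (\<lambda>_ _. True) sig (mat_entries a) (amp N e f))"
    unfolding gn L2_set_L2_set_cnm ..
  also have "\<dots> \<le> C * cnm ({..<k} \<times> {..<N}) f" by (rule C)
  also have "\<dots> \<le> C * ?X"
  proof (intro mult_left_mono C)
    have "cnm ({..<k} \<times> {..<N}) f = L2_set (\<lambda>v. norm (trunc k (x v))) {..<N}"
      unfolding L2_set_L2_set_cnm[symmetric] norm_trunc by (simp add: f_def)
    also have "\<dots> \<le> ?X" by (intro L2_set_mono norm_trunc_le norm_ge_zero)
    finally show "cnm ({..<k} \<times> {..<N}) f \<le> ?X" .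
  qed
  finally have G: "L2_set (\<lambda>v. norm (g v)) {..<N} \<le> C * ?X" .
  have "L2_set (\<lambda>v. norm (\<Sum>c<n. blinfun_apply (a c) (y (sig c v)))) {..<N} \<le>
      L2_set (\<lambda>v. norm (g v) + norm (\<Sum>c<n. d c (y (sig c v)))) {..<N}"
    unfolding split by (intro L2_set_mono norm_triangle_ineq norm_ge_zero)
  also have "\<dots> \<le> L2_set (\<lambda>v. norm (g v)) {..<N} + L2_set (\<lambda>v. norm (\<Sum>c<n. d c (y (sig c v)))) {..<N}"
    by (rule L2_set_triangle_ineq)
  also have "\<dots> \<le> C * ?X + real n * \<eta> * ?X" by (rule add_mono[OF G D])
  finally show ?thesis unfolding y_def by (simp add: algebra_simps)
qed

section \<open>The two completely bounded norms of an isomorphism onto a space of compact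
  operators\<close>

locale E1_into_compacts =
  fixes n :: nat and F :: "(ell2 \<Rightarrow>\<^sub>L ell2) set"
    and u :: "((nat \<Rightarrow> nat \<Rightarrow> complex) \<Rightarrow> complex) \<Rightarrow> ell2 \<Rightarrow>\<^sub>L ell2"
  assumes n: "2 \<le> n" and F: "csubspace F" "F \<subseteq> compact_operators"
    and u: "clinear_on (os_carrier (E1 n)) u" "bij_betw u (os_carrier (E1 n)) F"
begin

definition a :: "nat \<Rightarrow> ell2 \<Rightarrow>\<^sub>L ell2" where "a c = u (efun n (cdelta c))"

abbreviation "D \<equiv> 2 * sqrt (real n - 1)"
abbreviation "\<alpha> \<equiv> cb_norm (E1 n) (concrete_opspace F) u"
abbreviation "\<beta> \<equiv> cb_norm (concrete_opspace F) (E1 n) (inv_into (os_carrier (E1 n)) u)"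

lemma D_pos: "0 < D" using n by simp

lemma u_efun: "u (efun n t) = (\<Sum>c<n. t c *\<^sub>C a c)"
  unfolding a_def by (rule clinear_efun[OF u(1)])

lemma u_efun_in: "u (efun n t) \<in> F"
  using u(2) efun_in_carrier by (auto simp: bij_betw_def)

lemma a_lin: "clinear_on UNIV (blinfun_apply (a c))" and a_compact: "a c \<in> compact_operators"
  using u_efun_in[of "cdelta c"] F(2) by (auto simp: a_def compact_operators_def)

lemma inv_u: "inv_into (os_carrier (E1 n)) u (u (efun n t)) = efun n t"
  using u(2) efun_in_carrier by (simp add: bij_betw_def)

lemma u_efun_apply: "blinfun_apply (u (efun n t)) x = (\<Sum>c<n. t c *\<^sub>C blinfun_apply (a c) x)"
  by (simp add: u_efun blinfun.sum_left scaleC_blinfun.rep_eq)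

lemma sum_u_efun_apply:
  "(\<Sum>w<N. blinfun_apply (u (efun n (\<lambda>c. T c w))) (x w)) = (\<Sum>c<n. blinfun_apply (a c) (\<Sum>w<N. T c w *\<^sub>C x w))"
  unfolding u_efun_apply clinear_blinfun_sum[OF a_lin] by (rule sum.swap)

text \<open>Divided by \<open>\<rho>\<close>, the matrix
  \<open>\<Sum> a\<^sub>c \<otimes> x\<^sub>c e\<close> is in the unit ball over \<open>F\<close>,
  and its preimage has a norm bounded below by \<open>E1_norm_trace_ge\<close>.\<close>

lemma cb_inverse_ge:
  assumes sig: "partial_involutions n N (\<lambda>_ _. True) sig" and N: "0 < N" and \<rho>: "0 < \<rho>"
    and bd: "\<And>x. L2_set (\<lambda>v. norm (\<Sum>c<n. blinfun_apply (a c) (\<Sum>w<N. e (sig c v) w *\<^sub>C x w))) {..<N}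
      \<le> \<rho> * L2_set (\<lambda>w. norm (x w)) {..<N}"
  shows "ereal (real n * mtrace N e / (real N * \<rho>)) \<le> \<beta>"
proof -
  define e' where "e' v w = complex_of_real (1 / \<rho>) * e v w" for v w
  define X where "X v w = u (efun n (\<lambda>c. e' (sig c v) w))" for v w
  have "os_norm (concrete_opspace F) N X \<le> 1"
  proof (rule concrete_norm_leI)
    fix x :: "nat \<Rightarrow> ell2"
    define z where "z w = (1 / \<rho>) *\<^sub>R x w" for w
    have "(\<Sum>w<N. blinfun_apply (X v w) (x w)) = (\<Sum>c<n. blinfun_apply (a c) (\<Sum>w<N. e (sig c v) w *\<^sub>C z w))" for v
      unfolding X_def sum_u_efun_apply
      by (simp add: e'_def z_def scaleR_scaleC scaleC_scaleC mult.commute)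
    then have "L2_set (\<lambda>v. norm (\<Sum>w<N. blinfun_apply (X v w) (x w))) {..<N} \<le> \<rho> * L2_set (\<lambda>w. norm (z w)) {..<N}"
      using bd[of z] by simp
    also have "L2_set (\<lambda>w. norm (z w)) {..<N} = (1 / \<rho>) * L2_set (\<lambda>w. norm (x w)) {..<N}"
      unfolding z_def norm_scaleR using \<rho> by (subst L2_set_right_distrib) auto
    finally show "L2_set (\<lambda>v. norm (\<Sum>w<N. blinfun_apply (X v w) (x w))) {..<N} \<le> L2_set (\<lambda>w. norm (x w)) {..<N}"
      using \<rho> by simp
  qed
  then have "os_norm (E1 n) N (\<lambda>v w. inv_into (os_carrier (E1 n)) u (X v w)) \<le> \<beta>"
    using N u_efun_in by (intro cb_norm_ge) (auto simp: X_def concrete_opspace_def)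
  moreover have "ereal (real n * mtrace N e' / real N) \<le> os_norm (E1 n) N (\<lambda>v w. inv_into (os_carrier (E1 n)) u (X v w))"
    unfolding X_def inv_u by (rule E1_norm_trace_ge[OF sig N])
  moreover have "mtrace N e' = mtrace N e / \<rho>"
  proof -
    have "(\<Sum>v<N. e' v v) = complex_of_real (1 / \<rho>) * (\<Sum>v<N. e v v)"
      by (simp only: e'_def sum_distrib_left)
    then show ?thesis by (simp add: mtrace_def)
  qed
  ultimately show ?thesis by (simp add: field_simps)
qed

text \<open>The graph with one vertex and \<open>e = 1\<close> gives a positive lower bound.
  Positivity of both norms makes their product infinite as soon as one of them is.\<close>

lemma \<beta>_pos: "0 < \<beta>"
proof -
  define \<rho> where "\<rho> = (\<Sum>c<n. norm (a c)) + 1"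
  have \<rho>: "0 < \<rho>" unfolding \<rho>_def by (intro add_nonneg_pos sum_nonneg) auto
  have "ereal (real n * mtrace 1 (\<lambda>_ _. 1) / (real 1 * \<rho>)) \<le> \<beta>"
  proof (rule cb_inverse_ge[where sig = "\<lambda>c v. v"])
    fix x :: "nat \<Rightarrow> ell2"
    have "norm (\<Sum>c<n. blinfun_apply (a c) (x 0)) \<le> (\<Sum>c<n. norm (a c) * norm (x 0))"
      by (intro order_trans[OF norm_sum] sum_mono norm_blinfun)
    also have "\<dots> \<le> \<rho> * norm (x 0)"
      unfolding \<rho>_def sum_distrib_right[symmetric] by (intro mult_right_mono) auto
    finally show "L2_set (\<lambda>v. norm (\<Sum>c<n. blinfun_apply (a c) (\<Sum>w<1. 1 *\<^sub>C x w))) {..<1::nat}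
        \<le> \<rho> * L2_set (\<lambda>w. norm (x w)) {..<1}"
      by (simp add: L2_set_def scaleC_one)
  qed (auto simp: partial_involutions_def \<rho>)
  moreover have "0 < real n * mtrace 1 (\<lambda>_ _. 1) / (real 1 * \<rho>)"
    using n \<rho> by (simp add: mtrace_def)
  ultimately show ?thesis by (metis ereal_less(2) order.strict_trans2)
qed

context
  fixes R m N root act tau sig h lev Phi
  assumes cov: "tree_covering n R m N root act tau sig h lev Phi"
begin

interpretation tree_covering n R m N root act tau sig h lev Phi by (rule cov)

text \<open>Division by \<open>D\<close> puts the tree matrix into the unit ball over
  \<open>E1 n\<close>.\<close>

lemma u_tree_norm_le:
  "os_norm (concrete_opspace F) m
     (\<lambda>s t. u (efun n (\<lambda>c. if act c s \<and> tau c s = t then complex_of_real (1 / D) else 0))) \<le> \<alpha>"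
proof (rule cb_norm_ge)
  show "1 \<le> m" using root by simp
  show "efun n (\<lambda>c. if act c s \<and> tau c s = t then complex_of_real (1 / D) else 0) \<in> os_carrier (E1 n)" for s t
    by (rule efun_in_carrier)
  have "os_norm (E1 n) m (\<lambda>s t x. complex_of_real (1 / D) *
      efun n (\<lambda>c. if act c s \<and> tau c s = t then 1 else 0) x) \<le> ereal (1 / D * D)"
    using n D_pos by (intro E1_norm_scale_le E1_norm_tree_le) (auto simp: less_imp_le)
  moreover have "(\<lambda>x. complex_of_real (1 / D) * efun n (\<lambda>c. if act c s \<and> tau c s = t then 1 else 0) x) =
      efun n (\<lambda>c. if act c s \<and> tau c s = t then complex_of_real (1 / D) else 0)" for s t
    by (rule ext) (auto simp: efun_def sum_divide_distrib intro!: sum.cong)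
  moreover have "1 / D * D = 1" using D_pos by simp
  ultimately show "os_norm (E1 n) m (\<lambda>s t. efun n (\<lambda>c. if act c s \<and> tau c s = t then complex_of_real (1 / D) else 0)) \<le> 1"
    by (simp only: one_ereal_def)
qed

text \<open>The image of the tree matrix is applied to vectors supported in the first
  \<open>k\<close> coordinates, and only the first \<open>k\<close> coordinates of the result are
  read. This compression does not increase norms, so the bound is uniform in
  \<open>k\<close>.\<close>

lemma tree_cop_bound:
  assumes \<alpha>: "\<alpha> = ereal \<alpha>'" "0 \<le> \<alpha>'"
  shows "cnm ({..<k} \<times> {..<m}) (cop n k act tau (mat_entries a) f) \<le> \<alpha>' * D * cnm ({..<k} \<times> {..<m}) f"
proof -
  define x where "x t = (\<Sum>q<k. f (q, t) *\<^sub>C ebas q)" for t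
  define z where "z = complex_of_real (1 / D)"
  define y where "y s = (\<Sum>t<m. blinfun_apply (u (efun n (\<lambda>c. if act c s \<and> tau c s = t then z else 0))) (x t))" for s
  have x_nth: "ell2_nth (x t) q = (if q < k then f (q, t) else 0)" for t q
    by (simp add: x_def ell2_nth_sum scaleC_ell2.rep_eq ebas.rep_eq if_distrib[of "\<lambda>x. _ * x"] cong: if_cong)
  have xn: "L2_set (\<lambda>t. norm (x t)) {..<m} = cnm ({..<k} \<times> {..<m}) f"
  proof -
    have "norm (x t) = L2_set (\<lambda>q. cmod (f (q, t))) {..<k}" for t
      using norm_ell2_finite[of k "x t"] by (simp add: x_nth L2_set_def)
    then show ?thesis using L2_set_L2_set_cnm[of f] by simp
  qed
  have yx: "L2_set (\<lambda>s. norm (y s)) {..<m} \<le> \<alpha>' * L2_set (\<lambda>t. norm (x t)) {..<m}"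
    unfolding y_def z_def
    by (rule concrete_norm_apply_le[OF _ \<alpha>(2)]) (use u_tree_norm_le \<alpha>(1) in simp)
  have y_nth: "ell2_nth (y s) p = z * cop n k act tau (mat_entries a) f (p, s)" if "s < m" for s p
  proof -
    have ts: "(\<Sum>t<m. (if act c s \<and> tau c s = t then z else 0) *\<^sub>C x t) = (if act c s then z *\<^sub>C x (tau c s) else 0)"
      if "c < n" for c
    proof (cases "act c s")
      case True
      then have "tau c s < m" using tau that \<open>s < m\<close> by (auto simp: partial_involutions_def)
      then show ?thesis using True by (simp add: if_distrib[of "\<lambda>z. z *\<^sub>C _"] cong: if_cong)
    qed simp
    have "y s = (\<Sum>c<n. blinfun_apply (a c) (if act c s then z *\<^sub>C x (tau c s) else 0))"
      unfolding y_def sum_u_efun_apply using ts by (intro sum.cong) auto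
    also have "\<dots> = (\<Sum>c<n. if act c s then z *\<^sub>C blinfun_apply (a c) (x (tau c s)) else 0)"
      using a_lin by (intro sum.cong refl) (auto simp: clinear_on_def blinfun.zero_right)
    finally have ys: "y s = (\<Sum>c<n. if act c s then z *\<^sub>C blinfun_apply (a c) (x (tau c s)) else 0)" .
    have "ell2_nth (if act c s then z *\<^sub>C blinfun_apply (a c) (x (tau c s)) else 0) p =
        z * (if act c s then \<Sum>q<k. mat_entries a c p q * f (q, tau c s) else 0)" for c
      by (simp add: x_def mat_entries_apply[where a = a and c = c, OF a_lin] scaleC_ell2.rep_eq zero_ell2.rep_eq)
    then show ?thesis unfolding ys by (simp add: ell2_nth_sum cop_def sum_distrib_left)
  qed
  have "L2_set (\<lambda>p. cmod (z * cop n k act tau (mat_entries a) f (p, s))) {..<k} \<le> norm (y s)" if "s < m" for s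
  proof -
    have "L2_set (\<lambda>p. cmod (ell2_nth (y s) p)) {..<k} \<le> norm (y s)"
      unfolding norm_trunc[symmetric] by (rule norm_trunc_le)
    then show ?thesis using y_nth[OF that] by simp
  qed
  then have "L2_set (\<lambda>s. L2_set (\<lambda>p. cmod (z * cop n k act tau (mat_entries a) f (p, s))) {..<k}) {..<m}
      \<le> L2_set (\<lambda>s. norm (y s)) {..<m}"
    by (intro L2_set_mono) auto
  then have "cnm ({..<k} \<times> {..<m}) (\<lambda>i. z * cop n k act tau (mat_entries a) f i) \<le> L2_set (\<lambda>s. norm (y s)) {..<m}"
    using L2_set_L2_set_cnm[of "\<lambda>i. z * cop n k act tau (mat_entries a) f i"] by simp
  also note yx
  finally have "cmod z * cnm ({..<k} \<times> {..<m}) (cop n k act tau (mat_entries a) f) \<le> \<alpha>' * cnm ({..<k} \<times> {..<m}) f"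
    by (simp only: cnm_scale xn)
  moreover have "cmod z = 1 / D" unfolding z_def norm_of_real using D_pos by simp
  ultimately show ?thesis using D_pos by (simp add: field_simps)
qed

end

text \<open>The tree matrix has a nonzero entry and \<open>u\<close> is injective, so its image has
  nonzero norm.\<close>

lemma \<alpha>_pos: "0 < \<alpha>"
proof -
  \<comment> \<open>Radius 1 makes all edges at the root active.\<close>
  obtain m N root act tau sig h lev Phi where cov: "tree_covering n 1 m N root act tau sig h lev Phi"
    using ex_tree_covering[OF n] by blast
  interpret tree_covering n 1 m N root act tau sig h lev Phi by (rule cov)
  have act0: "act 0 root" using act[OF root(1)] root(2) n by simp
  define t where "t = tau 0 root"
  have tm: "t < m" using tau act0 root n by (auto simp: t_def partial_involutions_def)
  define Z where "Z s t = efun n (\<lambda>c. if act c s \<and> tau c s = t then complex_of_real (1 / D) else 0)" for s t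
  have le: "os_norm (concrete_opspace F) m (\<lambda>s t. u (Z s t)) \<le> \<alpha>"
    unfolding Z_def by (rule u_tree_norm_le[OF cov])
  have Z0: "Z root t \<noteq> efun n (\<lambda>_. 0)"
  proof
    define x where "x = (\<lambda>(i::nat) (j::nat). if i = 0 \<and> j = 0 then (1::complex) else 0)"
    have x: "x \<in> os_carrier (ell_infty n)" using n by (auto simp: carrier_ell_infty x_def)
    assume "Z root t = efun n (\<lambda>_. 0)"
    then have "Z root t x = 0" by (simp add: efun_def)
    moreover have "Z root t x = complex_of_real (1 / D)"
      using x n act0 by (simp add: Z_def efun_def) (simp add: x_def t_def if_distrib[of "\<lambda>x. _ * x"] cong: if_cong)
    ultimately show False using D_pos by simp
  qed
  have "u (Z root t) \<noteq> u (efun n (\<lambda>_. 0))"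
    using Z0 u(2) efun_in_carrier unfolding Z_def bij_betw_def by (meson inj_onD)
  then have "u (Z root t) \<noteq> 0" by (simp add: u_efun)
  then obtain y where y: "blinfun_apply (u (Z root t)) y \<noteq> 0" by (metis blinfun_eqI blinfun.zero_left)
  have "\<alpha> \<noteq> 0"
  proof
    assume "\<alpha> = 0"
    then have "os_norm (concrete_opspace F) m (\<lambda>s t. u (Z s t)) \<le> ereal 0" using le by (simp add: zero_ereal_def)
    from concrete_norm_apply_le[OF this order_refl, of "\<lambda>j. if j = t then y else 0"]
    have "L2_set (\<lambda>i. norm (\<Sum>j<m. blinfun_apply (u (Z i j)) (if j = t then y else 0))) {..<m} \<le> 0" by simp
    then have "L2_set (\<lambda>i. norm (\<Sum>j<m. blinfun_apply (u (Z i j)) (if j = t then y else 0))) {..<m} = 0"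
      by (simp add: order.antisym)
    then have "norm (\<Sum>j<m. blinfun_apply (u (Z root j)) (if j = t then y else 0)) = 0"
      using root(1) by (simp add: L2_set_eq_0_iff)
    moreover have "(\<Sum>j<m. blinfun_apply (u (Z root j)) (if j = t then y else 0)) = blinfun_apply (u (Z root t)) y"
      using tm by (simp add: if_distrib[of "blinfun_apply _"] blinfun.zero_right cong: if_cong)
    ultimately show False using y by simp
  qed
  moreover have "0 \<le> \<alpha>"
  proof -
    have "ereal 0 \<le> os_norm (concrete_opspace F) m (\<lambda>s t. u (Z s t))"
      using concrete_norm_ge[of "\<lambda>_. 0" m "\<lambda>s t. u (Z s t)" F] by (simp add: L2_set_def blinfun.zero_right)
    then show ?thesis using le by (simp add: zero_ereal_def)
  qed
  ultimately show ?thesis by simp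
qed

text \<open>The order of choices matters: \<open>\<epsilon>\<close> determines the size
  \<open>k\<close> of the corners by compactness, and only then is \<open>i\<close>, and with it the
  radius of the ball, taken so large that the lost proportion of the trace is at most
  \<open>\<epsilon>\<close>.\<close>

lemma cb_product_approx:
  assumes \<alpha>: "\<alpha> = ereal \<alpha>'" "0 \<le> \<alpha>'" and \<beta>: "\<beta> = ereal \<beta>'" and \<epsilon>: "0 < \<epsilon>"
  shows "real n * (1 - \<epsilon>) \<le> \<beta>' * (\<alpha>' * D + \<epsilon> + real n * \<epsilon>)"
proof -
  define C where "C = \<alpha>' * D"
  have C0: "0 \<le> C" using \<alpha> D_pos by (simp add: C_def)
  have "\<exists>K. \<forall>k\<ge>K. \<forall>x. norm (blinfun_apply (a c) x - trunc k (blinfun_apply (a c) (trunc k x))) \<le> \<epsilon> * norm x" for c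
    by (rule compact_approx[OF a_compact \<epsilon>])
  then obtain K where K: "\<And>c k x. K c \<le> k \<Longrightarrow>
      norm (blinfun_apply (a c) x - trunc k (blinfun_apply (a c) (trunc k x))) \<le> \<epsilon> * norm x" by metis
  define k where "k = Max (insert 0 (K ` {..<n}))"
  have k: "norm (blinfun_apply (a c) x - trunc k (blinfun_apply (a c) (trunc k x))) \<le> \<epsilon> * norm x" if "c < n" for c x
    using that by (intro K) (auto simp: k_def)
  \<comment> \<open>The cut is made at \<open>C + \<epsilon>\<close>, so the ratio of the tree bound
    to the cut is below 1 and its powers beat the factor \<open>k * k\<close>.\<close>
  define \<theta> where "\<theta> = C / (C + \<epsilon>)"
  have \<theta>: "0 \<le> \<theta>" "\<theta> < 1" using C0 \<epsilon> by (auto simp: \<theta>_def)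
  have "(\<lambda>i. real k * real k * \<theta> ^ i) \<longlonglongrightarrow> real k * real k * 0"
    using \<theta> by (intro tendsto_intros LIMSEQ_realpow_zero)
  then have "\<forall>\<^sub>F i in sequentially. real k * real k * \<theta> ^ i < \<epsilon>"
    using \<epsilon> by (intro order_tendstoD(2)) auto
  then obtain i where i: "\<And>j. i \<le> j \<Longrightarrow> real k * real k * \<theta> ^ j < \<epsilon>"
    by (auto simp: eventually_sequentially)
  \<comment> \<open>The exponent has the form \<open>4 * 2 ^ i\<close>, which exceeds
    \<open>i\<close>.\<close>
  have "i < 2 ^ i" by (rule less_exp)
  then have i': "real k * real k * (C / (C + \<epsilon>)) ^ (4 * 2 ^ i) \<le> \<epsilon>"
    unfolding \<theta>_def[symmetric] by (intro less_imp_le i) linarith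
  obtain m N root act tau sig h lev Phi where
    cov: "tree_covering n (4 * 2 ^ i) m N root act tau sig h lev Phi"
    using ex_tree_covering[OF n] by blast
  interpret tree_covering n "4 * 2 ^ i" m N root act tau sig h lev Phi by (rule cov)
  obtain e where e: "hproj N e" "real N * (1 - \<epsilon>) \<le> mtrace N e"
    "\<And>f. cnm ({..<k} \<times> {..<N}) (cop n k (\<lambda>_ _. True) sig (mat_entries a) (amp N e f))
      \<le> (C + \<epsilon>) * cnm ({..<k} \<times> {..<N}) f"
    using cop_projection[OF C0 tree_cop_bound[OF cov \<alpha>, folded C_def] _ order_refl i'] C0 \<epsilon> by auto
  define \<rho> where "\<rho> = C + \<epsilon> + real n * \<epsilon>"
  have \<rho>: "0 < \<rho>" using C0 \<epsilon> by (simp add: \<rho>_def add_nonneg_pos add_pos_nonneg)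
  have "ereal (real n * mtrace N e / (real N * \<rho>)) \<le> \<beta>"
    unfolding \<rho>_def
    by (rule cb_inverse_ge[OF sig N_pos \<rho>[unfolded \<rho>_def]],
        rule compact_tensor_cut_bound[OF a_lin k sig e(1) _ e(3)]) (use C0 \<epsilon> in auto)
  then have "real n * mtrace N e / (real N * \<rho>) \<le> \<beta>'" using \<beta> by simp
  then have "real n * mtrace N e \<le> \<beta>' * (real N * \<rho>)"
    using N_pos \<rho> by (simp add: pos_divide_le_eq)
  moreover have "real n * (real N * (1 - \<epsilon>)) \<le> real n * mtrace N e"
    by (intro mult_left_mono e) simp
  ultimately have "real N * (real n * (1 - \<epsilon>)) \<le> real N * (\<beta>' * \<rho>)" by (simp add: mult_ac)
  then show ?thesis using N_pos by (simp add: \<rho>_def C_def)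
qed

lemma cb_product_ge: "ereal (real n / D) \<le> \<alpha> * \<beta>"
proof (cases "\<alpha> = \<infinity> \<or> \<beta> = \<infinity>")
  case True
  then show ?thesis using \<alpha>_pos \<beta>_pos by auto
next
  case False
  then obtain \<alpha>' \<beta>' where ab: "\<alpha> = ereal \<alpha>'" "\<beta> = ereal \<beta>'"
    using \<alpha>_pos \<beta>_pos by (metis ereal_infty_less(2) less_ereal.simps(3) real_of_ereal.cases ereal_cases not_less_iff_gr_or_eq less_eq_ereal_def)
  then have pos: "0 < \<alpha>'" "0 < \<beta>'" using \<alpha>_pos \<beta>_pos by auto
  \<comment> \<open>\<open>M\<close> collects the coefficients of \<open>\<epsilon>\<close> in
    \<open>cb_product_approx\<close>, so that \<open>\<epsilon> = \<tau> / M\<close> costs exactly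
    \<open>\<tau>\<close>.\<close>
  define M where "M = real n + \<beta>' * (1 + real n)"
  have M: "0 < M" unfolding M_def using n pos by (intro add_pos_pos) auto
  have "real n \<le> \<beta>' * (\<alpha>' * D)"
  proof (rule field_le_epsilon)
    fix \<tau> :: real assume "0 < \<tau>"
    define \<sigma> where "\<sigma> = \<tau> / M"
    have \<sigma>: "0 < \<sigma>" "\<sigma> * M = \<tau>" using M \<open>0 < \<tau>\<close> by (simp_all add: \<sigma>_def)
    have "real n \<le> \<beta>' * (\<alpha>' * D) + \<sigma> * M"
      using cb_product_approx[OF ab(1) less_imp_le[OF pos(1)] ab(2) \<sigma>(1)]
      by (simp add: M_def algebra_simps)
    then show "real n \<le> \<beta>' * (\<alpha>' * D) + \<tau>" using \<sigma>(2) by simp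
  qed
  then have "real n / D \<le> \<alpha>' * \<beta>'" using D_pos by (simp add: pos_divide_le_eq mult_ac)
  then show ?thesis by (simp add: ab)
qed

end

theorem theorem7:
  "(\<forall>n\<ge>2. d_SK (E1 n) \<ge> ereal (real n / (2 * sqrt (real n - 1)))) \<and>
   (\<forall>n\<ge>3. d_SK (E1 n) > 1)"
proof -
  have 1: "ereal (real n / (2 * sqrt (real n - 1))) \<le> d_SK (E1 n)" if n: "2 \<le> n" for n
    unfolding d_SK_def d_cb_def
  proof (intro INF_greatest)
    fix F u
    assume "F \<in> {F. csubspace F \<and> closed F \<and> F \<subseteq> compact_operators}"
      "u \<in> {u. clinear_on (os_carrier (E1 n)) u \<and> bij_betw u (os_carrier (E1 n)) (os_carrier (concrete_opspace F))}"
    then have "E1_into_compacts n F u"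
      using n by unfold_locales (auto simp: concrete_opspace_def)
    then show "ereal (real n / (2 * sqrt (real n - 1))) \<le> cb_norm (E1 n) (concrete_opspace F) u *
        cb_norm (concrete_opspace F) (E1 n) (inv_into (os_carrier (E1 n)) u)"
      by (rule E1_into_compacts.cb_product_ge)
  qed
  have "1 < d_SK (E1 n)" if n: "3 \<le> n" for n
  proof -
    \<comment> \<open>Expanding this square gives \<open>4 * (n - 1) < n^2\<close>, which is strict
      because \<open>n \<noteq> 2\<close>.\<close>
    have "0 < (real n - 2)\<^sup>2" using n by simp
    then have "4 * (real n - 1) < (real n)\<^sup>2" by (simp add: power2_eq_square algebra_simps)
    then have "sqrt (4 * (real n - 1)) < real n" using n by (intro real_less_lsqrt) auto
    then have "2 * sqrt (real n - 1) < real n" by (simp only: real_sqrt_mult real_sqrt_four)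
    then have "1 < real n / (2 * sqrt (real n - 1))" using n by (simp add: pos_less_divide_eq)
    then have "1 < ereal (real n / (2 * sqrt (real n - 1)))" by (simp add: one_ereal_def)
    also have "\<dots> \<le> d_SK (E1 n)" using n by (intro 1) simp
    finally show ?thesis .
  qed
  with 1 show ?thesis by blast
qed

end
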